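(* Let $X=(X_t)_{t\ge 0}$ be a real-valued Lévy process with Lévy symbol $\eta$. Suppose that (A) $\dfrac{1}{q-\eta(u)}\in L^1(\mathbb{R})$ (as a function of $u$) for all $q>0$, and (B) $\displaystyle\int_0^1\left|\mathrm{Im}\left(\frac{u}{\eta(u)}\right)\right|du<\infty$. For $q>0$ and $x\in\mathbb{R}$ let $h_q(x):=r_q(0)-r_q(-x)$, where $r_q$ is the bounded continuous resolvent density of $X$. Then for all $x\in\mathbb{R}$, $$\lim_{q\downarrow0}h_q(x)=\frac1\pi\int_0^\infty\mathrm{Re}\left(\frac{e^{iux}-1}{\eta(u)}\right)du.$$
   Context: $\mathbb{P}_x$, $\mathbb{E}_x$ denote the law of $X$ started at $x$ and its expectation. The Lévy symbol $\eta$ is defined by $\mathbb{E}_0[e^{iuX_t}]=e^{t\eta(u)}$, with $$\eta(u)=ibu-\tfrac12au^2+\int_{\mathbb{R}\setminus\{0\}}\left(e^{iuy}-1-iuy1_{|y|\le1}\right)\nu(dy),$$ where $b\in\mathbb{R}$, $a\ge0$ and $\nu$ is a measure on $\mathbb{R}\setminus\{0\}$ with $\int(|y|^2\wedge1)\,\nu(dy)<\infty$. Resolvent: $R_qf(x):=\mathbb{E}_x\left[\int_0^\infty e^{-qt}f(X_t)\,dt\right]$ for bounded Borel $f$ and $q>0$. Under (A) there is, for each $q>0$, a (unique) bounded continuous resolvent density $r_q$, i.e. $R_qf(x)=\int_{\mathbb{R}}f(y)\,r_q(y-x)\,dy$ for all bounded Borel $f$ and all $x\in\mathbb{R}$. 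*)

theory Defs
  imports "HOL-Probability.Probability"
begin

locale levy_process = prob_space M for M :: "'a measure" +
  fixes X :: "real \<Rightarrow> 'a \<Rightarrow> real"
  assumes rv [measurable]: "\<And>t. 0 \<le> t \<Longrightarrow> random_variable borel (X t)"
    and start: "AE \<omega> in M. X 0 \<omega> = 0"
    and indep_increments:
      "\<And>n \<tau>. 0 \<le> \<tau> 0 \<Longrightarrow> (\<And>i. i < n \<Longrightarrow> \<tau> i < \<tau> (Suc i)) \<Longrightarrow>
         indep_vars (\<lambda>_. borel) (\<lambda>i \<omega>. X (\<tau> (Suc i)) \<omega> - X (\<tau> i) \<omega>) {..<n::nat}"
    and stationary_increments:
      "\<And>s t. 0 \<le> s \<Longrightarrow> 0 \<le> t \<Longrightarrow>
         distr M borel (\<lambda>\<omega>. X (s + t) \<omega> - X s \<omega>) = distr M borel (\<lambda>\<omega>. X t \<omega> - X 0 \<omega>)"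
    and right_continuous:
      "\<And>\<omega> t. \<omega> \<in> space M \<Longrightarrow> 0 \<le> t \<Longrightarrow> continuous (at_right t) (\<lambda>s. X s \<omega>)"
    and left_limits:
      "\<And>\<omega> t. \<omega> \<in> space M \<Longrightarrow> 0 < t \<Longrightarrow> \<exists>l. ((\<lambda>s. X s \<omega>) \<longlongrightarrow> l) (at_left t)"

text \<open>A measure on the punctured line is represented by a Borel measure on the whole line
  without mass at the origin.\<close>

definition levy_measure :: "real measure \<Rightarrow> bool" where
  "levy_measure \<nu> \<longleftrightarrow> sets \<nu> = sets borel \<and> emeasure \<nu> {0} = 0 \<and>
     (\<integral>\<^sup>+ y. ennreal (min (\<bar>y\<bar>\<^sup>2) 1) \<partial>\<nu>) < \<infinity>"

definition levy_khintchine :: "real \<Rightarrow> real \<Rightarrow> real measure \<Rightarrow> real \<Rightarrow> complex" where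
  "levy_khintchine b a \<nu> u =
     \<i> * of_real b * of_real u - of_real a * (of_real u)\<^sup>2 / 2 +
     (CLINT y|\<nu>. iexp (u * y) - 1 - \<i> * of_real u * of_real y * indicator {y. \<bar>y\<bar> \<le> 1} y)"

definition has_levy_symbol ::
    "'a measure \<Rightarrow> (real \<Rightarrow> 'a \<Rightarrow> real) \<Rightarrow> (real \<Rightarrow> complex) \<Rightarrow> bool" where
  "has_levy_symbol M X \<eta> \<longleftrightarrow>
     (\<forall>t\<ge>0. \<forall>u. (CLINT \<omega>|M. iexp (u * X t \<omega>)) = exp (of_real t * \<eta> u)) \<and>
     (\<exists>b a \<nu>. 0 \<le> a \<and> levy_measure \<nu> \<and> \<eta> = levy_khintchine b a \<nu>)"

text \<open>The measure \<open>M\<close> plays the role of the law with starting point \<open>0\<close>; the process started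
  at \<open>x\<close> is \<open>x + X\<close> under \<open>M\<close>.\<close>

definition resolvent ::
    "'a measure \<Rightarrow> (real \<Rightarrow> 'a \<Rightarrow> real) \<Rightarrow> real \<Rightarrow> (real \<Rightarrow> real) \<Rightarrow> real \<Rightarrow> real" where
  "resolvent M X q f x = (LINT \<omega>|M. (LBINT t:{0..}. exp (- q * t) * f (x + X t \<omega>)))"

text \<open>Taking \<open>f = 1\<close> shows that such an \<open>r\<close> is automatically Lebesgue integrable, since the
  resolvent is then \<open>1 / q \<noteq> 0\<close>; so the integrals on the right-hand side below are all genuine.\<close>

definition is_resolvent_density ::
    "'a measure \<Rightarrow> (real \<Rightarrow> 'a \<Rightarrow> real) \<Rightarrow> real \<Rightarrow> (real \<Rightarrow> real) \<Rightarrow> bool" where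
  "is_resolvent_density M X q r \<longleftrightarrow>
     continuous_on UNIV r \<and> bounded (range r) \<and>
     (\<forall>f \<in> borel_measurable borel. bounded (range f) \<longrightarrow>
        (\<forall>x. resolvent M X q f x = (LBINT y. f y * r (y - x))))"

definition resolvent_density ::
    "'a measure \<Rightarrow> (real \<Rightarrow> 'a \<Rightarrow> real) \<Rightarrow> real \<Rightarrow> real \<Rightarrow> real" where
  "resolvent_density M X q = (THE r. is_resolvent_density M X q r)"

definition h_resolvent ::
    "'a measure \<Rightarrow> (real \<Rightarrow> 'a \<Rightarrow> real) \<Rightarrow> real \<Rightarrow> real \<Rightarrow> real" where
  "h_resolvent M X q x = resolvent_density M X q 0 - resolvent_density M X q (- x)"

end

theory Submission
  imports Defs
begin

text \<open>Evaluate the process at an independent exponential time of rate \<open>q\<close>. The law has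
  characteristic function \<open>q / (q - \<eta>)\<close>, which is integrable by (A), so Levy's inversion theorem
  yields the continuous density \<open>q * r\<^sub>q\<close>, and after folding the inversion integral onto the
  half-line \<open>h\<^sub>q(x) = 1/\<pi> \<integral>\<^sub>0\<^sup>\<infinity> Re ((exp (iux) - 1) / (\<eta>(u) - q)) du\<close>. The limit is then dominated
  convergence. Near the origin \<open>-Re \<eta>(u) \<ge> c u\<^sup>2\<close>, since the only exception, a pure drift,
  violates (A); this controls the cosine part, and (B) controls the sine part. Away from the origin
  \<open>\<bar>\<eta>\<bar>\<close> is bounded below: \<open>1 / (1 - \<eta>)\<close> is uniformly continuous and integrable, hence vanishes at
  infinity, whereas a zero \<open>u \<noteq> 0\<close> of \<open>\<eta>\<close> would make it equal to 1 at all multiples of \<open>u\<close>.\<close>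

section \<open>Densities from integrable characteristic functions\<close>

text \<open>Fourier inversion integral of \<open>\<phi>\<close>. It is complex-valued for a general
  integrable \<open>\<phi>\<close>; the density of a law is obtained as its real part.\<close>

definition inverse_char :: "(real \<Rightarrow> complex) \<Rightarrow> real \<Rightarrow> complex" where
  "inverse_char \<phi> y = (CLBINT u. iexp (- (u * y)) * \<phi> u) / (2 * pi)"

lemma integrable_iexp_mult:
  assumes "integrable lborel \<phi>"
  shows "integrable lborel (\<lambda>u. iexp (u * y) * \<phi> u)"
proof (rule Bochner_Integration.integrable_bound[OF assms])
  have [measurable]: "\<phi> \<in> borel_measurable lborel" using assms by auto
  show "(\<lambda>u. iexp (u * y) * \<phi> u) \<in> borel_measurable lborel"
    by measurable
qed (simp add: norm_mult)

lemma norm_inverse_char_le: "norm (inverse_char \<phi> y) \<le> (LBINT u. norm (\<phi> u)) / (2 * pi)"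
proof -
  have "norm (CLBINT u. iexp (- (u * y)) * \<phi> u) \<le> (LBINT u. norm (iexp (- (u * y)) * \<phi> u))"
    by (rule integral_norm_bound)
  also have "\<dots> = (LBINT u. norm (\<phi> u))"
    by (intro Bochner_Integration.integral_cong refl) (simp add: norm_mult)
  finally show ?thesis
    by (simp add: inverse_char_def norm_divide divide_right_mono)
qed

lemma isCont_inverse_char:
  assumes "integrable lborel \<phi>"
  shows "isCont (inverse_char \<phi>) y"
  unfolding continuous_at_sequentially
proof safe
  fix X assume X: "X \<longlonglongrightarrow> y"
  have [measurable]: "\<phi> \<in> borel_measurable lborel" using assms by auto
  have "(\<lambda>n. CLBINT u. iexp (- (u * X n)) * \<phi> u) \<longlonglongrightarrow> (CLBINT u. iexp (- (u * y)) * \<phi> u)"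
    by (rule integral_dominated_convergence[where w="\<lambda>u. norm (\<phi> u)"])
       (use assms X in \<open>auto simp: norm_mult intro!: tendsto_intros\<close>)
  then show "(inverse_char \<phi> \<circ> X) \<longlonglongrightarrow> inverse_char \<phi> y"
    unfolding comp_def inverse_char_def by (intro tendsto_intros) auto
qed

text \<open>The kernel on the left is the integral of \<open>iexp (- (t * y))\<close> over
  \<open>y\<close> in \<open>{a..b}\<close>. Since \<open>\<phi>\<close> is integrable and the
  interval is bounded, the double integral converges absolutely and the order may be
  exchanged.\<close>

lemma Fubini_inverse_char:
  assumes \<phi>: "integrable lborel \<phi>" and "a \<le> b"
  shows "(CLBINT t. (iexp (- (t * a)) - iexp (- (t * b))) / (\<i> * t) * \<phi> t) =
    (CLBINT y. indicator {a..b} y *\<^sub>R (CLBINT t. iexp (- (t * y)) * \<phi> t))"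
proof -
  have [measurable]: "\<phi> \<in> borel_measurable lborel" using \<phi> by auto
  define g where "g = (\<lambda>(t, y). indicator {a..b} y *\<^sub>R (iexp (- (t * y)) * \<phi> t))"
  have g_meas[measurable]: "g \<in> borel_measurable (lborel \<Otimes>\<^sub>M lborel)"
    unfolding g_def by measurable
  have int_norm: "(LBINT y. norm (g (t, y))) = (b - a) * norm (\<phi> t)" for t
    unfolding g_def using \<open>a \<le> b\<close> by (simp add: norm_mult)
  have "integrable (lborel \<Otimes>\<^sub>M lborel) g"
  proof (rule lborel_pair.Fubini_integrable)
    show "integrable lborel (\<lambda>t. LBINT y. norm (g (t, y)))"
      unfolding int_norm using \<phi> by auto
    show "AE t in lborel. integrable lborel (\<lambda>y. g (t, y))"
    proof (rule AE_I2)
      fix t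
      have "set_integrable lborel {a..b} (\<lambda>y. iexp (- (t * y)) * \<phi> t)"
        by (intro borel_integrable_atLeastAtMost' continuous_intros)
      then show "integrable lborel (\<lambda>y. g (t, y))"
        by (simp add: g_def set_integrable_def)
    qed
  qed simp
  then have "(CLBINT y. CLBINT t. g (t, y)) = (CLBINT t. CLBINT y. g (t, y))"
    using lborel_pair.Fubini_integral[of "\<lambda>t y. g (t, y)"] by (simp add: case_prod_unfold)
  moreover have "(CLBINT t. CLBINT y. g (t, y)) =
    (CLBINT t. (iexp (- (t * a)) - iexp (- (t * b))) / (\<i> * t) * \<phi> t)"
  proof (rule integral_cong_AE)
    \<comment> \<open>At \<open>t = 0\<close> the quotient is 0 by the convention for division,
      whereas the inner integral is \<open>(b - a) * \<phi> 0\<close>; so equality is claimed off a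
      null set only.\<close>
    show "AE t in lborel. (CLBINT y. g (t, y)) = (iexp (- (t * a)) - iexp (- (t * b))) / (\<i> * t) * \<phi> t"
    proof (rule AE_I[of _ _ "{0}"], safe)
      fix t :: real assume ne: "(CLBINT y. g (t, y)) \<noteq> (iexp (- (t * a)) - iexp (- (t * b))) / (\<i> * t) * \<phi> t"
      show "t = 0"
      proof (rule ccontr)
        assume t: "t \<noteq> 0"
        let ?F = "\<lambda>y. \<i> / t * iexp (- (t * y)) * \<phi> t"
        have "(CLBINT y. g (t, y)) = ?F b - ?F a"
          unfolding g_def prod.case
        proof (rule integral_FTC_atLeastAtMost[OF \<open>a \<le> b\<close>])
          fix y
          let ?G = "\<lambda>z::complex. \<i> / t * exp (\<i> * (- (t * z))) * \<phi> t"
          have "(?G has_field_derivative iexp (- (t * y)) * \<phi> t) (at (of_real y))"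
            using t by (auto intro!: derivative_eq_intros)
          from has_vector_derivative_real_field[OF this]
          show "(?F has_vector_derivative iexp (- (t * y)) * \<phi> t) (at y within {a..b})"
            by simp
        qed (intro continuous_intros)
        also have "\<dots> = (iexp (- (t * a)) - iexp (- (t * b))) / (\<i> * t) * \<phi> t"
          using t by (simp add: field_simps)
        finally show False using ne by simp
      qed
    qed auto
  qed auto
  ultimately show ?thesis by (simp add: g_def)
qed

text \<open>Levy's inversion theorem gives the measure as a limit of integrals over
  \<open>{-T..T}\<close>. For an integrable characteristic function dominated convergence removes
  the truncation, and Fubini turns the result into an integral of the density.\<close>

lemma (in real_distribution) measure_Ioc_eq_integral_inverse_char:
  assumes \<phi>: "integrable lborel (char M)" and "a \<le> b"
    and "measure M {a} = 0" "measure M {b} = 0"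
  shows "complex_of_real (measure M {a<..b}) =
    (CLBINT y. indicator {a..b} y *\<^sub>R inverse_char (char M) y)"
proof -
  define f where "f t = (iexp (- (t * a)) - iexp (- (t * b))) / (\<i> * t) * char M t" for t :: real
  have [measurable]: "f \<in> borel_measurable borel" unfolding f_def by measurable
  have f_le: "norm (f t) \<le> (b - a) * norm (char M t)" for t
  proof (cases "t = 0")
    case False
    have "norm (f t) = norm ((iexp (t * - a) - iexp (t * - b)) / (\<i> * t)) * norm (char M t)"
      by (simp add: f_def norm_mult norm_divide)
    also have "\<dots> \<le> (- a - - b) * norm (char M t)"
      using \<open>a \<le> b\<close> False by (intro mult_right_mono Levy_Inversion_aux2) auto
    finally show ?thesis by simp
  qed (use \<open>a \<le> b\<close> in \<open>simp add: f_def\<close>)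
  have "(\<lambda>T::nat. CLBINT t=-T..T. f t) = (\<lambda>T. CLBINT t. indicator {- real T<..<real T} t *\<^sub>R f t)"
    by (auto simp: interval_lebesgue_integral_def set_lebesgue_integral_def fun_eq_iff)
  moreover have "(\<lambda>T. CLBINT t. indicator {- real T<..<real T} t *\<^sub>R f t) \<longlonglongrightarrow> (CLBINT t. f t)"
  proof (rule integral_dominated_convergence[where w="\<lambda>t. (b - a) * norm (char M t)"])
    show "AE t in lborel. (\<lambda>T. indicator {- real T<..<real T} t *\<^sub>R f t) \<longlonglongrightarrow> f t"
    proof (rule AE_I2)
      fix t :: real
      have "eventually (\<lambda>T::nat. indicator {- real T<..<real T} t *\<^sub>R f t = f t) sequentially"
        using eventually_gt_at_top[of "nat \<lceil>\<bar>t\<bar>\<rceil>"]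
        by eventually_elim (auto simp: indicator_def nat_less_iff ceiling_less_iff abs_less_iff; linarith)
      then show "(\<lambda>T. indicator {- real T<..<real T} t *\<^sub>R f t) \<longlonglongrightarrow> f t"
        by (rule tendsto_eventually)
    qed
    show "AE t in lborel. norm (indicator {- real T<..<real T} t *\<^sub>R f t) \<le> (b - a) * norm (char M t)" for T
      using f_le \<open>a \<le> b\<close> by (auto simp: indicator_def)
  qed (use \<phi> in auto)
  ultimately have "(\<lambda>T::nat. 1 / (2 * pi) * (CLBINT t=-T..T. f t)) \<longlonglongrightarrow> 1 / (2 * pi) * (CLBINT t. f t)"
    by (auto intro!: tendsto_intros)
  moreover have "(\<lambda>T::nat. 1 / (2 * pi) * (CLBINT t=-T..T. f t)) \<longlonglongrightarrow> measure M {a<..b}"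
    unfolding f_def using Levy_Inversion[OF assms(2-4)] .
  ultimately have "complex_of_real (measure M {a<..b}) = 1 / (2 * pi) * (CLBINT t. f t)"
    using LIMSEQ_unique by blast
  also have "\<dots> = 1 / (2 * pi) * (CLBINT y. indicator {a..b} y *\<^sub>R (CLBINT t. iexp (- (t * y)) * char M t))"
    unfolding f_def by (subst Fubini_inverse_char[OF \<phi> \<open>a \<le> b\<close>]) simp
  also have "\<dots> = (CLBINT y. indicator {a..b} y *\<^sub>R inverse_char (char M) y)"
    by (subst integral_mult_right_zero[symmetric]) (simp add: inverse_char_def)
  finally show ?thesis .
qed

text \<open>The difference \<open>H\<close> of \<open>cdf M\<close> and an antiderivative of the
  candidate density takes a single value on the points without mass. These are dense, and right
  continuity extends the constancy to the whole line.\<close>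

lemma (in real_distribution) cdf_has_derivative_inverse_char:
  assumes \<phi>: "integrable lborel (char M)"
  shows "(cdf M has_real_derivative Re (inverse_char (char M) x)) (at x)"
proof -
  let ?f = "inverse_char (char M)"
  have "\<exists>Q. \<forall>x. -\<infinity> < ereal x \<longrightarrow> ereal x < \<infinity> \<longrightarrow> (Q has_vector_derivative ?f x) (at x)"
    by (rule einterval_antiderivative) (use isCont_inverse_char[OF \<phi>] in auto)
  then obtain Q where Q: "\<And>x. (Q has_vector_derivative ?f x) (at x)" by auto
  have P: "((\<lambda>x. Re (Q x)) has_real_derivative Re (?f x)) (at x)" for x
    using Q[of x] by (simp add: has_vector_derivative_complex_iff)
  define H where "H x = cdf M x - Re (Q x)" for x
  define D where "D = {x. measure M {x} = 0}"
  have H_D: "H a = H b" if "a < b" "a \<in> D" "b \<in> D" for a b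
  proof -
    have "complex_of_real (cdf M b - cdf M a) = (CLBINT y. indicator {a..b} y *\<^sub>R ?f y)"
      using that measure_Ioc_eq_integral_inverse_char[OF \<phi>, of a b] by (simp add: cdf_diff_eq D_def)
    also have "\<dots> = Q b - Q a"
      using that
      by (intro integral_FTC_atLeastAtMost)
         (auto intro: Q[THEN has_vector_derivative_at_within] isCont_inverse_char[OF \<phi>] continuous_at_imp_continuous_on)
    finally have "cdf M b - cdf M a = Re (Q b - Q a)"
      by (metis Re_complex_of_real)
    then show ?thesis by (simp add: H_def)
  qed
  have H_D': "H a = H b" if "a \<in> D" "b \<in> D" for a b
    using H_D that by (metis linorder_less_linear)
  \<comment> \<open>A finite measure has only countably many atoms, so \<open>D\<close> meets every
    nonempty open interval.\<close>
  have dense: "\<exists>d\<in>D. u < d \<and> d < v" if "u < v" for u v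
    using open_minus_countable[OF countable_support, of "{u<..<v}"] that by (auto simp: D_def)
  obtain d where d: "d \<in> D" using dense[of 0 1] by force
  have H_right: "(H \<longlongrightarrow> H x) (at_right x)" for x
    unfolding H_def
  proof (rule tendsto_diff)
    show "(cdf M \<longlongrightarrow> cdf M x) (at_right x)"
      using cdf_is_right_cont[of x] by (simp add: continuous_within)
    show "((\<lambda>x. Re (Q x)) \<longlongrightarrow> Re (Q x)) (at_right x)"
      using P[THEN DERIV_isCont, of x] by (simp add: isCont_def filterlim_at_split)
  qed
  \<comment> \<open>A different value at \<open>x\<close> would persist on an interval to the right
    of \<open>x\<close>, and this interval contains a point of \<open>D\<close>.\<close>
  have H_const: "H x = H d" for x
  proof (rule ccontr)
    assume "H x \<noteq> H d"
    then have "eventually (\<lambda>y. H y \<noteq> H d) (at_right x)"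
      using H_right[of x] by (rule tendsto_imp_eventually_ne[rotated])
    then obtain b where "b > x" "\<And>y. x < y \<Longrightarrow> y < b \<Longrightarrow> H y \<noteq> H d"
      by (auto simp: eventually_at_right[OF less_add_one])
    with dense[of x b] H_D'[OF _ d] show False by blast
  qed
  have cdf_eq: "cdf M = (\<lambda>x. Re (Q x) + H d)"
    using H_const by (auto simp: fun_eq_iff H_def algebra_simps)
  show ?thesis
    unfolding cdf_eq using DERIV_add[OF P[of x] DERIV_const[of "H d"]] by simp
qed

lemma (in real_distribution) inverse_char_nonneg:
  assumes "integrable lborel (char M)"
  shows "0 \<le> Re (inverse_char (char M) x)"
  by (rule mono_on_imp_deriv_nonneg[OF _ cdf_has_derivative_inverse_char[OF assms], of UNIV])
     (auto intro!: mono_onI cdf_nondecreasing)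

text \<open>By the fundamental theorem of calculus both measures agree on half-open intervals, which
  form an intersection-stable generator of the Borel sets.\<close>

theorem (in real_distribution) eq_density_inverse_char:
  assumes \<phi>: "integrable lborel (char M)"
  shows "M = density lborel (\<lambda>x. Re (inverse_char (char M) x))"
proof (rule measure_eqI_generator_eq[where \<Omega>=UNIV and E="range (\<lambda>(a, b). {a <.. b::real})" and
      A="\<lambda>n. {- real n <.. real n}"])
  let ?r = "\<lambda>x. Re (inverse_char (char M) x)"
  have [measurable]: "?r \<in> borel_measurable borel"
    by (intro borel_measurable_continuous_onI continuous_on_Re continuous_at_imp_continuous_on)
       (auto intro: isCont_inverse_char[OF \<phi>])
  fix X assume "X \<in> range (\<lambda>(a, b). {a <.. b::real})"
  then obtain a b where X: "X = {a<..b}" by auto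
  show "emeasure M X = emeasure (density lborel (\<lambda>x. ennreal (?r x))) X"
  proof (cases "a \<le> b")
    case True
    have "emeasure (density lborel (\<lambda>x. ennreal (?r x))) X = (\<integral>\<^sup>+x. ennreal (?r x) * indicator {a..b} x \<partial>lborel)"
      unfolding X by (subst emeasure_density, simp, simp, intro nn_integral_cong_AE AE_I[of _ _ "{a}"])
        (auto simp: indicator_def)
    also have "\<dots> = cdf M b - cdf M a"
      by (intro nn_integral_FTC_Icc True cdf_has_derivative_inverse_char \<phi> inverse_char_nonneg) auto
    finally show ?thesis using True by (simp add: X emeasure_Ioc)
  qed (simp add: X)
next
  show "Int_stable (range (\<lambda>(a, b). {a <.. b::real}))"
    by (force intro!: Int_stableI)
  show "sets M = sigma_sets UNIV (range (\<lambda>(a, b). {a <.. b::real}))"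
    by (simp add: borel_sigma_sets_Ioc)
  show "sets (density lborel (\<lambda>x. ennreal (Re (inverse_char (char M) x)))) = sigma_sets UNIV (range (\<lambda>(a, b). {a <.. b::real}))"
    by (simp add: borel_sigma_sets_Ioc)
qed (auto simp: UN_Ioc_eq_UNIV)

section \<open>Characteristic functions: decay at infinity and the value 1\<close>

text \<open>If \<open>norm (f u)\<close> were at least \<open>e\<close> for arbitrarily large
  \<open>u\<close>, uniform continuity would keep it above \<open>e / 2\<close> on windows of fixed
  length, contradicting that the tail integrals tend to 0.\<close>

lemma uniformly_continuous_integrable_tendsto_0:
  fixes f :: "real \<Rightarrow> complex"
  assumes uc: "uniformly_continuous_on UNIV f" and int: "integrable lborel f"
  shows "(f \<longlongrightarrow> 0) at_top"
proof (rule tendstoI, rule ccontr)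
  fix e :: real assume e: "0 < e" and "\<not> eventually (\<lambda>u. dist (f u) 0 < e) at_top"
  then have freq: "\<exists>u\<ge>N. e \<le> norm (f u)" for N
    unfolding eventually_at_top_linorder by (auto simp: not_less)
  obtain d where d: "0 < d" "\<And>u v. dist v u < d \<Longrightarrow> dist (f v) (f u) < e / 2"
    using uc e unfolding uniformly_continuous_on_def by (metis UNIV_I half_gt_zero)
  have [measurable]: "f \<in> borel_measurable borel" using int by auto
  have lim: "(\<lambda>n::nat. LBINT u. indicator {real n..} u * norm (f u)) \<longlonglongrightarrow> (LBINT u::real. 0)"
  proof (rule integral_dominated_convergence[where w="\<lambda>u. norm (f u)"])
    show "AE u in lborel. (\<lambda>n. indicator {real n..} u * norm (f u)) \<longlonglongrightarrow> 0"
    proof (rule AE_I2, rule tendsto_eventually)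
      fix u :: real
      show "eventually (\<lambda>n. indicator {real n..} u * norm (f u) = 0) sequentially"
        using eventually_gt_at_top[of "nat \<lceil>u\<rceil>"]
        by eventually_elim (auto simp: indicator_def nat_less_iff ceiling_less_iff)
    qed
  qed (use int in \<open>auto simp: indicator_def\<close>)
  have "0 < d / 2 * (e / 2)" using d e by simp
  then have "eventually (\<lambda>n::nat. (LBINT u. indicator {real n..} u * norm (f u)) < d / 2 * (e / 2)) sequentially"
    using lim by (intro order_tendstoD(2)) auto
  then obtain N :: nat where N: "(LBINT u. indicator {real N..} u * norm (f u)) < d / 2 * (e / 2)"
    by (auto simp: eventually_sequentially)
  obtain u where u: "real N \<le> u" "e \<le> norm (f u)" using freq by blast
  \<comment> \<open>The window lies beyond \<open>N\<close>. Its length \<open>d / 2\<close> keeps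
    even its closed endpoint strictly within distance \<open>d\<close> of \<open>u\<close>.\<close>
  have "(LBINT v. (e / 2) * indicator {u..u + d / 2} v) \<le> (LBINT u. indicator {real N..} u * norm (f u))"
  proof (rule integral_mono)
    show "integrable lborel (\<lambda>u. indicator {real N..} u * norm (f u))"
      by (rule Bochner_Integration.integrable_bound[OF int]) (auto simp: indicator_def)
    show "e / 2 * indicator {u..u + d / 2} v \<le> indicator {real N..} v * norm (f v)" for v
    proof (cases "v \<in> {u..u + d / 2}")
      case True
      then have "dist (f v) (f u) < e / 2"
        using d by (intro d(2)) (auto simp: dist_real_def)
      then have "e / 2 \<le> norm (f v)"
        using u(2) norm_triangle_ineq2[of "f u" "f v"] by (simp add: dist_norm norm_minus_commute)
      then show ?thesis using True u(1) by (simp add: indicator_def)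
    next
      case False
      then have "indicator {u..u + d / 2} v = (0::real)" by (rule indicator_simps(2))
      then show ?thesis by simp
    qed
  qed (use d in auto)
  moreover have "(LBINT v. (e / 2) * indicator {u..u + d / 2} v) = d / 2 * (e / 2)"
    using d by simp
  ultimately show False using N by linarith
qed

text \<open>The increment from \<open>u\<close> to \<open>v\<close> is bounded by
  \<open>k (v - u)\<close>, which depends on the difference alone and tends to 0 at the origin by
  dominated convergence.\<close>

lemma (in real_distribution) uniformly_continuous_char: "uniformly_continuous_on UNIV (char M)"
proof -
  define k where "k s = (LINT y|M. norm (iexp (s * y) - 1))" for s
  have "isCont k 0"
    unfolding continuous_at_sequentially
  proof safe
    fix S assume S: "S \<longlonglongrightarrow> (0::real)"
    have "(\<lambda>n. LINT y|M. norm (iexp (S n * y) - 1)) \<longlonglongrightarrow> (LINT y|M. norm (iexp (0 * y) - 1))"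
    proof (rule integral_dominated_convergence[where w="\<lambda>_. 2"])
      show "AE y in M. (\<lambda>n. norm (iexp (S n * y) - 1)) \<longlonglongrightarrow> norm (iexp (0 * y) - 1)"
        using S by (intro AE_I2 tendsto_intros)
      show "AE y in M. norm (norm (iexp (S n * y) - 1)) \<le> 2" for n
        by (intro AE_I2) (use norm_triangle_ineq4[of "iexp (S n * _)" 1] in simp)
    qed auto
    then show "(k \<circ> S) \<longlonglongrightarrow> k 0" by (simp add: k_def comp_def)
  qed
  moreover have "k 0 = 0" by (simp add: k_def)
  ultimately have k: "(k \<longlongrightarrow> 0) (at 0)" by (simp add: isCont_def)
  have le: "norm (char M v - char M u) \<le> k (v - u)" for u v
  proof -
    have "char M v - char M u = (CLINT y|M. iexp (v * y) - iexp (u * y))"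
      unfolding char_def by (intro Bochner_Integration.integral_diff[symmetric] integrable_iexp) auto
    also have "norm \<dots> \<le> (LINT y|M. norm (iexp (v * y) - iexp (u * y)))"
      by (rule integral_norm_bound)
    also have "\<dots> = k (v - u)"
      unfolding k_def
    proof (intro Bochner_Integration.integral_cong refl)
      fix y
      have "iexp (v * y) - iexp (u * y) = iexp (u * y) * (iexp ((v - u) * y) - 1)"
        by (simp add: right_diff_distrib mult_exp_exp algebra_simps)
      then show "norm (iexp (v * y) - iexp (u * y)) = norm (iexp ((v - u) * y) - 1)"
        by (simp add: norm_mult)
    qed
    finally show ?thesis .
  qed
  show ?thesis
    unfolding uniformly_continuous_on_def
  proof safe
    fix e :: real assume e: "0 < e"
    with k obtain d where d: "0 < d" "\<And>s. s \<noteq> 0 \<Longrightarrow> \<bar>s\<bar> < d \<Longrightarrow> \<bar>k s\<bar> < e"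
      unfolding tendsto_iff eventually_at by (auto simp: dist_real_def)
    have "dist (char M v) (char M u) < e" if "dist v u < d" for u v
      using d(2)[of "v - u"] le[of v u] that e by (cases "v = u") (auto simp: dist_norm)
    then show "\<exists>d>0. \<forall>x\<in>UNIV. \<forall>x'\<in>UNIV. dist x' x < d \<longrightarrow> dist (char M x') (char M x) < e"
      using d(1) by blast
  qed
qed

lemma (in real_distribution) char_minus: "char M (- u) = cnj (char M u)"
  unfolding char_def Bochner_Integration.integral_cnj[symmetric]
  by (intro Bochner_Integration.integral_cong refl) (simp add: exp_cnj)

lemma (in real_distribution) char_tendsto_0:
  assumes "integrable lborel (char M)"
  shows "(char M \<longlongrightarrow> 0) at_top"
  using uniformly_continuous_char assms by (rule uniformly_continuous_integrable_tendsto_0)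

text \<open>A distribution with \<open>char M u = 1\<close> lives on the lattice \<open>(2 * pi / u) * \<int>\<close>, so its
  characteristic function is periodic.\<close>

lemma (in real_distribution) char_eq_1_mult:
  assumes "char M u = 1"
  shows "char M (real n * u) = 1"
proof -
  have int: "integrable M (\<lambda>y. cos (u * y))"
    by (rule integrable_const_bound[where B=1]) auto
  have "Re (char M u) = (LINT y|M. Re (iexp (u * y)))"
    unfolding char_def by (intro integral_Re[symmetric] integrable_iexp) auto
  then have "(LINT y|M. cos (u * y)) = 1"
    using assms by (simp add: Re_exp)
  \<comment> \<open>A nonnegative function with integral 0 vanishes almost everywhere, which places
    almost every \<open>y\<close> on the lattice.\<close>
  then have "(LINT y|M. 1 - cos (u * y)) = 0"
    using int prob_space by simp
  moreover have "integrable M (\<lambda>y. 1 - cos (u * y))" using int by auto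
  ultimately have "AE y in M. 1 - cos (u * y) = 0"
    by (subst (asm) integral_nonneg_eq_0_iff_AE) auto
  then have "AE y in M. iexp (real n * u * y) = 1"
  proof eventually_elim
    case (elim y)
    then have "cos (u * y) = 1" by simp
    moreover from this have "sin (u * y) = 0"
      using sin_cos_squared_add[of "u * y"] by simp
    ultimately have "iexp (u * y) = 1"
      by (simp add: complex_eq_iff Re_exp Im_exp)
    then have "exp (of_nat n * (\<i> * complex_of_real (u * y))) = 1"
      by (simp only: exp_of_nat_mult power_one)
    then show ?case by (simp add: mult_ac)
  qed
  then have "char M (real n * u) = (CLINT y|M. 1)"
    unfolding char_def by (intro integral_cong_AE) auto
  then show ?thesis using prob_space by simp
qed

text \<open>The value 1 would recur at all multiples of \<open>u\<close>, against the decay at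
  infinity.\<close>

lemma (in real_distribution) char_neq_1:
  assumes "integrable lborel (char M)" "0 < u"
  shows "char M u \<noteq> 1"
proof
  assume 1: "char M u = 1"
  have "filterlim (\<lambda>n. real n * u) at_top sequentially"
    using assms(2) by (intro filterlim_at_top_mult_tendsto_pos[OF tendsto_const]) (auto intro: filterlim_real_sequentially)
  then have "(\<lambda>n. char M (real n * u)) \<longlonglongrightarrow> 0"
    by (rule filterlim_compose[OF char_tendsto_0[OF assms(1)]])
  then show False by (simp add: char_eq_1_mult[OF 1] LIMSEQ_const_iff)
qed

section \<open>Resolvent densities\<close>

lemma LBINT_exp_complex:
  assumes c: "0 < Re c"
  shows "(CLBINT t:{0<..}. exp (- (c * of_real t))) = 1 / c"
proof -
  let ?F = "\<lambda>t::real. - (1 / c) * exp (- (c * of_real t))"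
  have c0: "c \<noteq> 0" using c by auto
  have "(CLBINT t=0..\<infinity>. exp (- (c * of_real t))) = 0 - ?F 0"
  proof (rule interval_integral_FTC_integrable)
    fix x
    show "(?F has_vector_derivative exp (- (c * of_real x))) (at x)"
      by (rule has_vector_derivative_real_field) (use c0 in \<open>auto intro!: derivative_eq_intros\<close>)
    show "isCont (\<lambda>t. exp (- (c * of_real t))) x"
      by (intro continuous_intros)
  next
    show "set_integrable lborel (einterval 0 \<infinity>) (\<lambda>t. exp (- (c * of_real t)))"
      by (rule set_integrable_bound[where f="\<lambda>t. exp (- (t * Re c))"])
         (use integrable_I0i_exp_mscale[OF c] in
           \<open>auto simp: set_borel_measurable_def mult.commute zero_ereal_def\<close>)
    have "isCont ?F 0" by (intro continuous_intros)
    then show "((?F \<circ> real_of_ereal) \<longlongrightarrow> ?F 0) (at_right 0)"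
      by (simp add: zero_ereal_def ereal_tendsto_simps isCont_def filterlim_at_split)
    have "((\<lambda>t. norm (exp (- (c * of_real t)))) \<longlongrightarrow> 0) at_top"
    proof -
      have "filterlim (\<lambda>t. Re c * t) at_top at_top"
        using c by (intro filterlim_tendsto_pos_mult_at_top[OF tendsto_const] filterlim_ident)
      then have "((\<lambda>t. exp (- (Re c * t))) \<longlongrightarrow> 0) at_top"
        by (intro filterlim_compose[OF exp_at_bot] filterlim_compose[OF filterlim_uminus_at_bot_at_top])
      then show ?thesis by simp
    qed
    then have "(?F \<longlongrightarrow> - (1 / c) * 0) at_top"
      by (rule tendsto_mult[OF tendsto_const tendsto_norm_zero_cancel])
    then show "((?F \<circ> real_of_ereal) \<longlongrightarrow> 0) (at_left \<infinity>)"
      by (simp add: ereal_tendsto_simps)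
  qed simp
  then show ?thesis
    by (simp add: interval_lebesgue_integral_def zero_ereal_def)
qed

text \<open>The set where \<open>g\<close> is nonzero is open and null, hence empty.\<close>

lemma continuous_nonneg_integral_eq_0:
  fixes g :: "real \<Rightarrow> real"
  assumes "continuous_on UNIV g" "\<And>x. 0 \<le> g x" "integrable lborel g" "(LBINT x. g x) = 0"
  shows "g x = 0"
proof -
  have "AE x in lborel. g x = 0"
    using assms integral_nonneg_eq_0_iff_AE[of lborel g] by auto
  then have "emeasure lborel {x. g x \<noteq> 0} = 0"
    using borel_measurable_continuous_onI[OF assms(1)] by (subst (asm) AE_iff_measurable[OF _ refl]) auto
  moreover have "open {x. g x \<noteq> 0}"
    using assms(1) by (intro open_Collect_neq continuous_on_const)
  ultimately have "negligible {x. g x \<noteq> 0}"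
    unfolding negligible_iff_null_sets by (intro null_sets_completionI null_setsI) auto
  with \<open>open {x. g x \<noteq> 0}\<close> have "{x. g x \<noteq> 0} = {}"
    using open_not_negligible by blast
  then show ?thesis by auto
qed

text \<open>The difference \<open>d\<close> of two densities is itself bounded and continuous, hence
  an admissible test function. Testing both densities with it shows that \<open>d * d\<close> has
  integral 0.\<close>

lemma is_resolvent_density_unique:
  assumes r: "is_resolvent_density M X q r" and s: "is_resolvent_density M X q s"
    and one: "resolvent M X q (\<lambda>_. 1) 0 \<noteq> 0"
  shows "r = s"
proof -
  have int: "integrable lborel g" and bnd: "bounded (range g)" and cont: "continuous_on UNIV g"
    if "is_resolvent_density M X q g" for g
  proof -
    show "bounded (range g)" "continuous_on UNIV g"
      using that by (auto simp: is_resolvent_density_def)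
    have "resolvent M X q (\<lambda>_. 1) 0 = (LBINT y. 1 * g (y - 0))"
      using that unfolding is_resolvent_density_def by auto
    \<comment> \<open>The integral of a non-integrable function is 0 by convention, so the nonzero
      value supplied by \<open>one\<close> forces integrability.\<close>
    then show "integrable lborel g"
      using one not_integrable_integral_eq[of lborel g] by auto
  qed
  define d where "d x = r x - s x" for x
  have d_cont: "continuous_on UNIV d"
    unfolding d_def using cont[OF r] cont[OF s] by (intro continuous_intros)
  then have [measurable]: "d \<in> borel_measurable borel"
    by (rule borel_measurable_continuous_onI)
  have d_bnd: "bounded (range d)"
    unfolding d_def using bnd[OF r] bnd[OF s] by (rule bounded_minus_comp)
  then obtain B where B: "\<And>x. \<bar>d x\<bar> \<le> B" by (auto simp: bounded_iff)
  have int_d: "integrable lborel (\<lambda>x. d x * g x)" if "integrable lborel g" for g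
    by (rule Bochner_Integration.integrable_bound[OF integrable_mult_right[OF that, of B]])
       (use that B in \<open>auto simp: abs_mult intro!: mult_mono order.trans[OF B]\<close>)
  have "resolvent M X q d 0 = (LBINT y. d y * g (y - 0))" if "is_resolvent_density M X q g" for g
    using that d_bnd unfolding is_resolvent_density_def by simp
  from this[OF r] this[OF s] have "(LBINT y. d y * r y) = (LBINT y. d y * s y)"
    by simp
  then have "(LBINT y. d y * r y - d y * s y) = 0"
    using int[OF r] int[OF s] by (subst Bochner_Integration.integral_diff) (auto intro: int_d)
  then have 0: "(LBINT y. d y * d y) = 0"
    by (simp add: d_def right_diff_distrib)
  have "d x * d x = 0" for x
  proof (rule continuous_nonneg_integral_eq_0[where g="\<lambda>x. d x * d x"])
    show "integrable lborel (\<lambda>x. d x * d x)"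
      using int[OF r] int[OF s] by (intro int_d) (simp add: d_def)
  qed (use d_cont 0 in \<open>auto intro!: continuous_intros\<close>)
  then show ?thesis by (auto simp: d_def fun_eq_iff)
qed

section \<open>The process at an independent exponential time\<close>

locale levy_process_symbol = levy_process +
  fixes \<eta> :: "real \<Rightarrow> complex"
  assumes symbol: "0 \<le> t \<Longrightarrow> (CLINT \<omega>|M. iexp (u * X t \<omega>)) = exp (of_real t * \<eta> u)"
begin

text \<open>Joint measurability follows from right continuity: the path is the pointwise limit of
  its values at grid points of mesh \<open>1 / Suc n\<close> to the right of the time. The maximum
  with 0 extends paths to negative times, where nothing is assumed about \<open>X\<close>.\<close>

lemma measurable_path [measurable]:
  "(\<lambda>z. X (max 0 (fst z)) (snd z)) \<in> borel_measurable (borel \<Otimes>\<^sub>M M)"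
proof (rule borel_measurable_LIMSEQ_metric)
  fix n :: nat
  have "(\<lambda>z. nat \<lfloor>max 0 (fst z :: real) * Suc n\<rfloor>) \<in> measurable (borel \<Otimes>\<^sub>M M) (count_space UNIV)"
    by (rule measurable_compose[of "\<lambda>z. max 0 (fst z :: real) * Suc n" _ borel "\<lambda>x. nat \<lfloor>x\<rfloor>"]; measurable)
  moreover have "(\<lambda>z. X ((real i + 1) / Suc n) (snd z)) \<in> borel_measurable (borel \<Otimes>\<^sub>M M)" for i :: nat
    by (rule measurable_compose[OF measurable_snd]) (rule rv, simp)
  ultimately show "(\<lambda>z. X ((real (nat \<lfloor>max 0 (fst z :: real) * Suc n\<rfloor>) + 1) / Suc n) (snd z))
      \<in> borel_measurable (borel \<Otimes>\<^sub>M M)"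
    by (rule measurable_compose_countable[rotated])
next
  fix z :: "real \<times> 'a" assume "z \<in> space (borel \<Otimes>\<^sub>M M)"
  then have "snd z \<in> space M" by (auto simp: space_pair_measure)
  define t :: real where "t = max 0 (fst z)"
  have t: "0 \<le> t" by (simp add: t_def)
  let ?s = "\<lambda>n. (real (nat \<lfloor>t * Suc n\<rfloor>) + 1) / Suc n"
  \<comment> \<open>The \<open>+ 1\<close> in the numerator puts the grid point strictly to the
    right of \<open>t\<close>, as convergence along \<open>at_right t\<close> demands.\<close>
  have gt: "t < ?s n" and le: "?s n \<le> t + inverse (real (Suc n))" for n
  proof -
    have "0 \<le> \<lfloor>t * Suc n\<rfloor>" using t by simp
    then have *: "real (nat \<lfloor>t * Suc n\<rfloor>) = of_int \<lfloor>t * Suc n\<rfloor>" by simp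
    have "t * Suc n < real (nat \<lfloor>t * Suc n\<rfloor>) + 1" "real (nat \<lfloor>t * Suc n\<rfloor>) \<le> t * Suc n"
      unfolding * by linarith+
    then have "t < ?s n" "real (nat \<lfloor>t * Suc n\<rfloor>) / Suc n \<le> t"
      by (simp_all only: pos_less_divide_eq pos_divide_le_eq of_nat_0_less_iff zero_less_Suc)
    then show "t < ?s n" "?s n \<le> t + inverse (real (Suc n))"
      by (simp_all add: add_divide_distrib inverse_eq_divide)
  qed
  have "?s \<longlonglongrightarrow> t"
  proof (rule tendsto_sandwich[where f="\<lambda>_. t" and h="\<lambda>n. t + inverse (real (Suc n))"])
    show "(\<lambda>n. t + inverse (real (Suc n))) \<longlonglongrightarrow> t"
      using LIMSEQ_inverse_real_of_nat_add .
    show "eventually (\<lambda>n. t \<le> ?s n) sequentially"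
      "eventually (\<lambda>n. ?s n \<le> t + inverse (real (Suc n))) sequentially"
      by (intro always_eventually allI less_imp_le gt le)+
  qed simp
  then have "filterlim ?s (at_right t) sequentially"
    using less_imp_neq[OF gt, THEN not_sym] gt
    by (simp only: filterlim_at greaterThan_iff) (simp only: simp_thms eventually_True)
  moreover have "((\<lambda>s. X s (snd z)) \<longlongrightarrow> X t (snd z)) (at_right t)"
    using right_continuous[OF \<open>snd z \<in> space M\<close> t] by (simp add: continuous_within)
  ultimately show "(\<lambda>n. X ((real (nat \<lfloor>max 0 (fst z :: real) * Suc n\<rfloor>) + 1) / Suc n) (snd z))
      \<longlonglongrightarrow> X (max 0 (fst z)) (snd z)"
    unfolding t_def[symmetric] by (rule filterlim_compose[rotated])
qed

text \<open>The modulus of the characteristic function of \<open>X 1\<close> is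
  \<open>exp (Re (\<eta> u))\<close> and is at most 1.\<close>

lemma Re_symbol_nonpos: "Re (\<eta> u) \<le> 0"
proof -
  have "exp (Re (\<eta> u)) = norm (CLINT \<omega>|M. iexp (u * X 1 \<omega>))"
    using symbol[of 1 u] by simp
  also have "\<dots> \<le> (LINT \<omega>|M. norm (iexp (u * X 1 \<omega>)))"
    by (rule integral_norm_bound)
  also have "\<dots> = 1" by (simp add: prob_space)
  finally show ?thesis by simp
qed

text \<open>The law of \<open>X\<close> at an independent exponential time of rate \<open>q\<close>; it equals \<open>q\<close> times the
  \<open>q\<close>-resolvent measure.\<close>

definition exp_time_law :: "real \<Rightarrow> real measure" where
  "exp_time_law q = distr (density lborel (exponential_density q) \<Otimes>\<^sub>M M) borel
     (\<lambda>z. X (max 0 (fst z)) (snd z))"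

context
  fixes q :: real
  assumes q: "0 < q"
begin

interpretation E: prob_space "density lborel (exponential_density q)"
  using q by (rule prob_space_exponential_density)

interpretation P: pair_prob_space "density lborel (exponential_density q)" M ..

lemma measurable_path' [measurable]:
  "(\<lambda>z. X (max 0 (fst z)) (snd z)) \<in> borel_measurable (density lborel (exponential_density q) \<Otimes>\<^sub>M M)"
  using measurable_path by (simp cong: measurable_cong_sets sets_pair_measure_cong)

lemma real_distribution_exp_time_law: "real_distribution (exp_time_law q)"
  unfolding exp_time_law_def by (rule P.real_distribution_distr) measurable

text \<open>Both orders of Fubini are recorded: the first computes the characteristic function from
  the known one at fixed times, the second has the order of integration of
  \<open>resolvent\<close>.\<close>

lemma integral_exp_time_law:
  fixes f :: "real \<Rightarrow> 'b::{banach, second_countable_topology}"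
  assumes [measurable]: "f \<in> borel_measurable borel" and B: "\<And>y. norm (f y) \<le> B"
  shows "(LINT y|exp_time_law q. f y) =
      (LINT t|density lborel (exponential_density q). LINT \<omega>|M. f (X (max 0 t) \<omega>))"
    and "(LINT y|exp_time_law q. f y) =
      (LINT \<omega>|M. LINT t|density lborel (exponential_density q). f (X (max 0 t) \<omega>))"
proof -
  let ?g = "\<lambda>t \<omega>. f (X (max 0 t) \<omega>)"
  have "integrable (density lborel (exponential_density q) \<Otimes>\<^sub>M M) (case_prod ?g)"
    by (rule P.integrable_const_bound[where B=B]) (use B in \<open>auto simp: case_prod_unfold\<close>)
  moreover have "(LINT y|exp_time_law q. f y) =
      integral\<^sup>L (density lborel (exponential_density q) \<Otimes>\<^sub>M M) (case_prod ?g)"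
    unfolding exp_time_law_def by (subst integral_distr) (auto simp: case_prod_unfold)
  ultimately show
    "(LINT y|exp_time_law q. f y) =
      (LINT t|density lborel (exponential_density q). LINT \<omega>|M. f (X (max 0 t) \<omega>))"
    "(LINT y|exp_time_law q. f y) =
      (LINT \<omega>|M. LINT t|density lborel (exponential_density q). f (X (max 0 t) \<omega>))"
    using P.integral_fst'[of "case_prod ?g"] P.integral_snd[of ?g] by simp_all
qed

lemma integral_exponential_density:
  fixes f :: "real \<Rightarrow> 'b::{banach, second_countable_topology}"
  assumes "f \<in> borel_measurable borel"
  shows "(LINT t|density lborel (exponential_density q). f t) = (LBINT t:{0<..}. (q * exp (- q * t)) *\<^sub>R f t)"
proof -
  have "(LINT t|density lborel (exponential_density q). f t) = (LBINT t. exponential_density q t *\<^sub>R f t)"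
    using assms q by (intro integral_density) (auto simp: exponential_density_nonneg)
  also have "\<dots> = (LBINT t:{0<..}. (q * exp (- q * t)) *\<^sub>R f t)"
    unfolding set_lebesgue_integral_def
    using assms by (intro integral_cong_AE AE_I[of _ _ "{0}"])
      (auto simp: exponential_density_def indicator_def mult.commute)
  finally show ?thesis .
qed

text \<open>Averaging \<open>exp (t * \<eta> u)\<close> over an exponential time gives
  \<open>q\<close> times the Laplace integral of \<open>exp (- ((q - \<eta> u) * t))\<close>, which
  converges because \<open>Re (q - \<eta> u)\<close> is at least \<open>q\<close>.\<close>

lemma char_exp_time_law: "char (exp_time_law q) u = q / (q - \<eta> u)"
proof -
  have "char (exp_time_law q) u =
      (CLINT t|density lborel (exponential_density q). CLINT \<omega>|M. iexp (u * X (max 0 t) \<omega>))"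
    unfolding char_def by (rule integral_exp_time_law(1)[where B=1]) simp_all
  also have "\<dots> = (CLINT t|density lborel (exponential_density q). exp (of_real (max 0 t) * \<eta> u))"
    by (simp only: symbol max.cobounded1)
  also have "\<dots> = (CLBINT t:{0<..}. (q * exp (- q * t)) *\<^sub>R exp (of_real (max 0 t) * \<eta> u))"
    by (rule integral_exponential_density) measurable
  also have "\<dots> = (CLBINT t:{0<..}. q * exp (- ((q - \<eta> u) * of_real t)))"
  proof (intro set_lebesgue_integral_cong ballI allI impI)
    fix t :: real assume "t \<in> {0<..}"
    moreover have "of_real (exp (- q * t)) * exp (of_real t * \<eta> u) = exp (- ((q - \<eta> u) * of_real t))"
      unfolding exp_of_real[symmetric] mult_exp_exp by (rule arg_cong[where f=exp]) (simp add: algebra_simps)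
    ultimately show "(q * exp (- q * t)) *\<^sub>R exp (of_real (max 0 t) * \<eta> u) =
        q * exp (- ((q - \<eta> u) * of_real t))"
      by (simp add: scaleR_conv_of_real mult.assoc)
  qed simp
  also have "\<dots> = q / (q - \<eta> u)"
    using Re_symbol_nonpos[of u] q by (simp add: LBINT_exp_complex)
  finally show ?thesis .
qed

lemma resolvent_eq_integral_exp_time_law:
  assumes [measurable]: "f \<in> borel_measurable borel" and "bounded (range f)"
  shows "resolvent M X q f x = (LINT y|exp_time_law q. f (x + y)) / q"
proof -
  obtain B where B: "\<And>y. norm (f y) \<le> B" using assms(2) by (auto simp: bounded_iff)
  have "(LINT y|exp_time_law q. f (x + y)) =
      (LINT \<omega>|M. LINT t|density lborel (exponential_density q). f (x + X (max 0 t) \<omega>))"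
    by (rule integral_exp_time_law(2)[where B=B]) (use B in auto)
  also have "\<dots> = (LINT \<omega>|M. q * (LBINT t:{0..}. exp (- q * t) * f (x + X t \<omega>)))"
  proof (rule Bochner_Integration.integral_cong[OF refl])
    fix \<omega> assume \<omega>: "\<omega> \<in> space M"
    have path [measurable]: "(\<lambda>t. X (max 0 t) \<omega>) \<in> borel_measurable borel"
      using measurable_compose[OF measurable_Pair2'[OF \<omega>] measurable_path] by simp
    have "(LINT t|density lborel (exponential_density q). f (x + X (max 0 t) \<omega>)) =
       (LBINT t:{0<..}. (q * exp (- q * t)) *\<^sub>R f (x + X (max 0 t) \<omega>))"
      by (rule integral_exponential_density) measurable
    also have "\<dots> = (LBINT t:{0..}. (q * exp (- q * t)) *\<^sub>R f (x + X (max 0 t) \<omega>))"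
      unfolding set_lebesgue_integral_def
      by (intro integral_cong_AE AE_I[of _ _ "{0}"]) (auto simp: indicator_def)
    also have "\<dots> = (LBINT t:{0..}. q * (exp (- q * t) * f (x + X t \<omega>)))"
      by (intro set_lebesgue_integral_cong) auto
    also have "\<dots> = q * (LBINT t:{0..}. exp (- q * t) * f (x + X t \<omega>))"
      by simp
    finally show "(LINT t|density lborel (exponential_density q). f (x + X (max 0 t) \<omega>)) =
      q * (LBINT t:{0..}. exp (- q * t) * f (x + X t \<omega>))" .
  qed
  finally show ?thesis
    using q by (simp add: resolvent_def)
qed

text \<open>The law at the exponential time has characteristic function
  \<open>q * (1 / (q - \<eta> u))\<close>, so inversion gives it the density \<open>q * ?r\<close>.
  Dividing by \<open>q\<close> yields a resolvent density, and uniqueness evaluates the definite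
  description.\<close>

lemma resolvent_density_eq:
  assumes A: "integrable lborel (\<lambda>u. 1 / (q - \<eta> u))"
  shows "resolvent_density M X q = (\<lambda>y. Re (inverse_char (\<lambda>u. 1 / (q - \<eta> u)) y))"
proof -
  interpret \<mu>: real_distribution "exp_time_law q" by (rule real_distribution_exp_time_law)
  let ?r = "\<lambda>y. Re (inverse_char (\<lambda>u. 1 / (q - \<eta> u)) y)"
  have char: "char (exp_time_law q) = (\<lambda>u. q * (1 / (q - \<eta> u)))"
    by (simp add: char_exp_time_law fun_eq_iff)
  have int: "integrable lborel (char (exp_time_law q))"
    unfolding char using A by (rule integrable_mult_right)
  have inv: "Re (inverse_char (char (exp_time_law q)) y) = q * ?r y" for y
  proof -
    have "(CLBINT u. iexp (- (u * y)) * char (exp_time_law q) u) =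
        (CLBINT u. q * (iexp (- (u * y)) * (1 / (q - \<eta> u))))"
      by (intro Bochner_Integration.integral_cong) (simp_all add: char)
    also have "\<dots> = q * (CLBINT u. iexp (- (u * y)) * (1 / (q - \<eta> u)))"
      by (rule integral_mult_right_zero)
    finally have "inverse_char (char (exp_time_law q)) y = q * inverse_char (\<lambda>u. 1 / (q - \<eta> u)) y"
      unfolding inverse_char_def by simp
    then show ?thesis by simp
  qed
  have r_nonneg: "0 \<le> ?r y" for y
    using \<mu>.inverse_char_nonneg[OF int, of y] q by (simp add: inv zero_le_mult_iff)
  have r_cont: "continuous_on UNIV ?r"
    by (intro continuous_on_Re continuous_at_imp_continuous_on ballI isCont_inverse_char A)
  then have [measurable]: "?r \<in> borel_measurable borel"
    by (rule borel_measurable_continuous_onI)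
  have dens: "is_resolvent_density M X q ?r"
    unfolding is_resolvent_density_def
  proof (intro conjI ballI impI allI r_cont)
    show "bounded (range ?r)"
      unfolding bounded_iff
      by (auto intro!: exI order.trans[OF abs_Re_le_cmod norm_inverse_char_le])
    fix f :: "real \<Rightarrow> real" and x assume [measurable]: "f \<in> borel_measurable borel" and f: "bounded (range f)"
    have "(LINT y|exp_time_law q. f (x + y)) = (LINT y|density lborel (\<lambda>y. ennreal (q * ?r y)). f (x + y))"
      by (subst \<mu>.eq_density_inverse_char[OF int]) (simp add: inv)
    also have "\<dots> = (LBINT y. (q * ?r y) *\<^sub>R f (x + y))"
      using r_nonneg q by (intro integral_density) auto
    also have "\<dots> = q * (LBINT y. f (x + y) * ?r y)"
      by (subst integral_mult_right_zero[symmetric]) (simp add: mult_ac)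
    \<comment> \<open>Translation invariance of Lebesgue measure moves the starting point from
      \<open>f\<close> into the density.\<close>
    also have "(LBINT y. f (x + y) * ?r y) = (LBINT y. f y * ?r (y - x))"
      using lborel_integral_real_affine[of 1 "\<lambda>y. f y * ?r (y - x)" x] by simp
    finally show "resolvent M X q f x = (LBINT y. f y * ?r (y - x))"
      using q f by (simp add: resolvent_eq_integral_exp_time_law)
  qed
  have "resolvent M X q (\<lambda>_. 1) 0 = 1 / q"
    using \<mu>.prob_space by (subst resolvent_eq_integral_exp_time_law) auto
  then have one: "resolvent M X q (\<lambda>_. 1) 0 \<noteq> 0" using q by simp
  show ?thesis
    unfolding resolvent_density_def
    by (rule the_equality[of "is_resolvent_density M X q", OF dens])
       (rule is_resolvent_density_unique[OF _ dens one])
qed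

end

section \<open>Continuity and symmetry of the symbol\<close>

interpretation \<mu>: real_distribution "exp_time_law 1"
  by (rule real_distribution_exp_time_law) simp

lemma char_exp_time_law_1: "char (exp_time_law 1) = (\<lambda>u. 1 / (1 - \<eta> u))"
  using char_exp_time_law[of 1] by (simp add: fun_eq_iff)

lemma symbol_neq: "0 < q \<Longrightarrow> \<eta> u \<noteq> of_real q"
  using Re_symbol_nonpos[of u] by auto

text \<open>Solving \<open>1 / (1 - \<eta>)\<close> for \<open>\<eta>\<close> lets the symbol
  inherit continuity and conjugate symmetry from a characteristic function.\<close>

lemma symbol_eq_char: "\<eta> u = 1 - 1 / char (exp_time_law 1) u"
  using symbol_neq[of 1 u] by (simp add: char_exp_time_law_1)

lemma isCont_symbol: "isCont \<eta> u"
proof -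
  have "char (exp_time_law 1) u \<noteq> 0"
    using symbol_neq[of 1 u] by (simp add: char_exp_time_law_1)
  then have "isCont (\<lambda>u. 1 - 1 / char (exp_time_law 1) u) u"
    by (intro continuous_intros \<mu>.isCont_char)
  then show ?thesis using symbol_eq_char by presburger
qed

lemma borel_measurable_symbol [measurable]: "\<eta> \<in> borel_measurable borel"
  by (intro borel_measurable_continuous_onI continuous_at_imp_continuous_on ballI isCont_symbol)

lemma symbol_minus: "\<eta> (- u) = cnj (\<eta> u)"
  by (simp add: symbol_eq_char \<mu>.char_minus)

end

section \<open>The symbol near the origin\<close>

text \<open>The Taylor remainder \<open>\<bar>x\<bar> ^ 3 / 6\<close> is at most one sixth of the
  square of \<open>x\<close> here, and 1/2 - 1/6 = 1/3.\<close>

lemma one_minus_cos_ge: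
  assumes "\<bar>x\<bar> \<le> (1::real)"
  shows "x\<^sup>2 / 3 \<le> 1 - cos x"
proof -
  have "cos x - (1 - x\<^sup>2 / 2) = Re (iexp x - (\<Sum>k\<le>2. (\<i> * x) ^ k / fact k))"
    by (simp add: eval_nat_numeral Re_exp)
  also have "\<dots> \<le> norm (iexp x - (\<Sum>k\<le>2. (\<i> * x) ^ k / fact k))"
    by (rule complex_Re_le_cmod)
  also have "\<dots> \<le> \<bar>x\<bar> ^ 3 / 6"
    using iexp_approx1[of x 2] by (simp add: eval_nat_numeral)
  also have "\<bar>x\<bar> ^ 3 \<le> x\<^sup>2"
    using assms power_decreasing[of 2 3 "\<bar>x\<bar>"] by simp
  finally show ?thesis by simp
qed

lemma one_minus_cos_le: "1 - cos x \<le> x\<^sup>2 / (2::real)"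
proof -
  have "1 - cos x = 2 * (sin (x / 2))\<^sup>2"
    using cos_double_sin[of "x / 2"] by simp
  also have "(sin (x / 2))\<^sup>2 \<le> (x / 2)\<^sup>2"
    using abs_sin_x_le_abs_x[of "x / 2"] by (metis abs_le_square_iff)
  finally show ?thesis by (simp add: power_divide)
qed

text \<open>This excludes a pure drift as symbol, including \<open>b = 0\<close>. The modulus
  dominates \<open>1 / (1 + \<beta> * u)\<close> on the positive half-line, whose integrals grow
  logarithmically.\<close>

lemma not_integrable_inverse_linear:
  "\<not> integrable lborel (\<lambda>u. 1 / (1 - \<i> * of_real b * of_real u))"
proof
  assume int: "integrable lborel (\<lambda>u. 1 / (1 - \<i> * of_real b * of_real u))"
  \<comment> \<open>Adding 1 keeps \<open>\<beta>\<close> positive for \<open>b = 0\<close> as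
    well.\<close>
  define \<beta> where "\<beta> = \<bar>b\<bar> + 1"
  have \<beta>: "0 < \<beta>" by (simp add: \<beta>_def)
  define C where "C = (LBINT u. norm (1 / (1 - \<i> * of_real b * of_real u)))"
  have ln_le: "ln (1 + \<beta> * T) / \<beta> \<le> C" if "0 \<le> T" for T
  proof -
    have hb: "has_bochner_integral lborel (\<lambda>u. 1 / (1 + \<beta> * u) * indicator {0..T} u)
        (ln (1 + \<beta> * T) / \<beta> - ln (1 + \<beta> * 0) / \<beta>)"
    proof (rule has_bochner_integral_FTC_Icc_real[OF that])
      fix u assume "0 \<le> u" "u \<le> T"
      then have "0 < 1 + \<beta> * u" using \<beta> by (simp add: add_pos_nonneg)
      then show "((\<lambda>u. ln (1 + \<beta> * u) / \<beta>) has_real_derivative 1 / (1 + \<beta> * u)) (at u)"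
        using \<beta> by (auto intro!: derivative_eq_intros)
      show "isCont (\<lambda>u. 1 / (1 + \<beta> * u)) u"
        using \<open>0 < 1 + \<beta> * u\<close> by (intro continuous_intros) auto
    qed
    then have "ln (1 + \<beta> * T) / \<beta> = (LBINT u. 1 / (1 + \<beta> * u) * indicator {0..T} u)"
      by (simp add: has_bochner_integral_iff)
    also have "\<dots> \<le> C"
      unfolding C_def
    proof (rule integral_mono)
      show "integrable lborel (\<lambda>u. 1 / (1 + \<beta> * u) * indicator {0..T} u)"
        using hb by (simp add: has_bochner_integral_iff)
      show "integrable lborel (\<lambda>u. norm (1 / (1 - \<i> * of_real b * of_real u)))"
        using int by (rule integrable_norm)
      show "1 / (1 + \<beta> * u) * indicator {0..T} u \<le> norm (1 / (1 - \<i> * of_real b * of_real u))" for u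
      proof (cases "u \<in> {0..T}")
        case True
        have "norm (1 - \<i> * of_real b * of_real u) \<le> 1 + \<bar>b\<bar> * u"
          using norm_triangle_ineq4[of 1 "\<i> * of_real b * of_real u"] True by (simp add: norm_mult)
        also have "\<dots> \<le> 1 + \<beta> * u" using True by (simp add: \<beta>_def algebra_simps)
        finally have "norm (1 - \<i> * of_real b * of_real u) \<le> 1 + \<beta> * u" .
        moreover have "1 - \<i> * of_real b * of_real u \<noteq> 0" by (simp add: complex_eq_iff)
        moreover have "0 < 1 + \<beta> * u" using True \<beta> by (simp add: add_pos_nonneg)
        ultimately show ?thesis
          using True by (auto simp: norm_divide intro!: divide_left_mono mult_pos_pos)
      next
        case False
        then have "indicator {0..T} u = (0::real)" by (rule indicator_simps(2))
        then show ?thesis by simp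
      qed
    qed
    finally show ?thesis .
  qed
  \<comment> \<open>Chosen so that the logarithmic lower bound equals \<open>C + 1\<close>.\<close>
  define T where "T = (exp (\<beta> * (C + 1)) - 1) / \<beta>"
  have "0 \<le> C" unfolding C_def by simp
  then have "0 \<le> T" using \<beta> by (simp add: T_def)
  moreover have "ln (1 + \<beta> * T) / \<beta> = C + 1" using \<beta> by (simp add: T_def)
  ultimately show False using ln_le[of T] by simp
qed

lemma integrable_min_levy_measure:
  assumes "levy_measure \<nu>"
  shows "integrable \<nu> (\<lambda>y. min (\<bar>y\<bar>\<^sup>2) 1)"
proof (rule integrableI_bounded)
  have [measurable_cong]: "sets \<nu> = sets borel" using assms by (simp add: levy_measure_def)
  show "(\<lambda>y. min (\<bar>y\<bar>\<^sup>2) 1) \<in> borel_measurable \<nu>" by measurable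
  show "(\<integral>\<^sup>+ y. ennreal (norm (min (\<bar>y\<bar>\<^sup>2) (1::real))) \<partial>\<nu>) < \<infinity>"
    using assms by (simp add: levy_measure_def)
qed

text \<open>For \<open>\<bar>y\<bar> \<le> 1\<close> the integrand is a second-order Taylor
  remainder, and elsewhere it is at most 2 in modulus; the constant \<open>u\<^sup>2 / 2 + 2\<close>
  serves both ranges.\<close>

lemma integrable_levy_khintchine:
  assumes \<nu>: "levy_measure \<nu>"
  shows "integrable \<nu> (\<lambda>y. iexp (u * y) - 1 - \<i> * of_real u * of_real y * indicator {y. \<bar>y\<bar> \<le> 1} y)"
    (is "integrable \<nu> ?f")
proof (rule Bochner_Integration.integrable_bound)
  have [measurable_cong]: "sets \<nu> = sets borel" using \<nu> by (simp add: levy_measure_def)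
  show "integrable \<nu> (\<lambda>y. (u\<^sup>2 / 2 + 2) * min (\<bar>y\<bar>\<^sup>2) 1)"
    using integrable_min_levy_measure[OF \<nu>] by (rule integrable_mult_right)
  show "?f \<in> borel_measurable \<nu>" by measurable
  show "AE y in \<nu>. norm (?f y) \<le> norm ((u\<^sup>2 / 2 + 2) * min (\<bar>y\<bar>\<^sup>2) 1)"
  proof (rule AE_I2)
    fix y
    show "norm (?f y) \<le> norm ((u\<^sup>2 / 2 + 2) * min (\<bar>y\<bar>\<^sup>2) 1)"
    proof (cases "\<bar>y\<bar> \<le> 1")
      case True
      have "indicator {y. \<bar>y\<bar> \<le> 1} y = (1 :: complex)"
        using True by simp
      then have "norm (?f y) = norm (iexp (u * y) - (\<Sum>k\<le>1. (\<i> * (u * y)) ^ k / fact k))"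
        by (simp add: algebra_simps)
      also have "\<dots> \<le> \<bar>u * y\<bar> ^ Suc 1 / fact (Suc 1)"
        by (rule iexp_approx1)
      also have "\<dots> = \<bar>u * y\<bar>\<^sup>2 / 2"
        by (simp add: numeral_2_eq_2)
      also have "\<dots> \<le> (u\<^sup>2 / 2 + 2) * y\<^sup>2"
        by (simp add: power_mult_distrib algebra_simps)
      also have "\<dots> = (u\<^sup>2 / 2 + 2) * min (\<bar>y\<bar>\<^sup>2) 1"
        using True by (simp add: abs_square_le_1 min_absorb1)
      finally show ?thesis by simp
    next
      case False
      then have "norm (?f y) \<le> 2"
        using norm_triangle_ineq4[of "iexp (u * y)" 1] by simp
      also have "\<dots> \<le> (u\<^sup>2 / 2 + 2) * min (\<bar>y\<bar>\<^sup>2) 1"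
        using False one_le_power[of "\<bar>y\<bar>" 2] by (simp add: min_absorb2 del: power2_abs)
      finally show ?thesis by simp
    qed
  qed
qed

text \<open>The negative real part is the sum of the Gaussian term and the integral of
  \<open>1 - cos (u * y)\<close>. A positive \<open>a\<close> suffices by itself; otherwise the
  jumps of size at most some \<open>K\<close> contribute quadratically near the origin.\<close>

lemma levy_khintchine_Re_lower_bound:
  assumes a: "0 \<le> a" and \<nu>: "levy_measure \<nu>"
    and drift: "\<not> (\<forall>u. levy_khintchine b a \<nu> u = \<i> * of_real b * of_real u)"
  shows "\<exists>c>0. \<exists>d>0. \<forall>u. 0 < u \<longrightarrow> u < d \<longrightarrow> c * u\<^sup>2 \<le> - Re (levy_khintchine b a \<nu> u)"
proof -
  have [measurable_cong]: "sets \<nu> = sets borel" using \<nu> by (simp add: levy_measure_def)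
  let ?f = "\<lambda>u y. iexp (u * y) - 1 - \<i> * of_real u * of_real y * indicator {y. \<bar>y\<bar> \<le> 1} y"
  have cos_eq: "(\<lambda>y. 1 - cos (u * y)) = (\<lambda>y. - Re (?f u y))" for u
    by (auto simp: Re_exp indicator_def)
  have int_cos: "integrable \<nu> (\<lambda>y. 1 - cos (u * y))" for u
    unfolding cos_eq by (intro Bochner_Integration.integrable_minus integrable_Re integrable_levy_khintchine \<nu>)
  have Re_eq: "- Re (levy_khintchine b a \<nu> u) = a * u\<^sup>2 / 2 + (LINT y|\<nu>. 1 - cos (u * y))" for u
  proof -
    have "(LINT y|\<nu>. 1 - cos (u * y)) = - Re (CLINT y|\<nu>. ?f u y)"
      unfolding cos_eq using integral_Re[OF integrable_levy_khintchine[OF \<nu>, of u]]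
      by (simp only: Bochner_Integration.integral_minus)
    then show ?thesis
      by (simp add: levy_khintchine_def power2_eq_square)
  qed
  show ?thesis
  proof (cases "a = 0")
    case False
    have "a / 2 * u\<^sup>2 \<le> - Re (levy_khintchine b a \<nu> u)" for u
      unfolding Re_eq by (simp add: integral_nonneg_AE)
    then show ?thesis using False a by (intro exI[of _ "a / 2"] conjI exI[of _ 1]) auto
  next
    case True
    \<comment> \<open>The second moment of \<open>\<nu>\<close> truncated at \<open>K\<close>:
      truncation makes it finite and later allows \<open>u * y\<close> to be kept within the unit
      interval.\<close>
    define J where "J K = (LINT y|\<nu>. y\<^sup>2 * indicator {y. \<bar>y\<bar> \<le> real K} y)" for K
    have int_J: "integrable \<nu> (\<lambda>y. y\<^sup>2 * indicator {y. \<bar>y\<bar> \<le> real K} y)" for K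
    proof (rule Bochner_Integration.integrable_bound)
      show "integrable \<nu> (\<lambda>y. ((real K)\<^sup>2 + 1) * min (\<bar>y\<bar>\<^sup>2) 1)"
        using integrable_min_levy_measure[OF \<nu>] by (rule integrable_mult_right)
      show "AE y in \<nu>. norm (y\<^sup>2 * indicator {y. \<bar>y\<bar> \<le> real K} y) \<le> norm (((real K)\<^sup>2 + 1) * min (\<bar>y\<bar>\<^sup>2) 1)"
      proof (rule AE_I2)
        fix y
        have "y\<^sup>2 \<le> ((real K)\<^sup>2 + 1) * min (y\<^sup>2) 1" if "\<bar>y\<bar> \<le> real K"
        proof -
          have "y\<^sup>2 \<le> (real K)\<^sup>2" using that by (simp add: abs_le_square_iff[symmetric])
          then show ?thesis by (auto simp: min_def algebra_simps)
        qed
        then show "norm (y\<^sup>2 * indicator {y. \<bar>y\<bar> \<le> real K} y) \<le> norm (((real K)\<^sup>2 + 1) * min (\<bar>y\<bar>\<^sup>2) 1)"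
          by (auto simp: indicator_def)
      qed
    qed measurable
    \<comment> \<open>If every truncated moment vanished, \<open>\<nu>\<close> would have no mass
      away from 0, and with \<open>a = 0\<close> only the excluded drift would remain.\<close>
    have "\<exists>K. 0 < J K"
    proof (rule ccontr)
      assume "\<not> (\<exists>K. 0 < J K)"
      moreover have "0 \<le> J K" for K unfolding J_def by (auto intro!: integral_nonneg_AE)
      ultimately have "J K = 0" for K by (metis order_le_less)
      then have "AE y in \<nu>. y\<^sup>2 * indicator {y. \<bar>y\<bar> \<le> real K} y = 0" for K
        using integral_nonneg_eq_0_iff_AE[OF int_J[of K]] unfolding J_def by auto
      then have "AE y in \<nu>. \<forall>K. y\<^sup>2 * indicator {y. \<bar>y\<bar> \<le> real K} y = 0"
        unfolding AE_all_countable by blast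
      then have "AE y in \<nu>. y = 0"
      proof eventually_elim
        case (elim y)
        obtain K :: nat where "\<bar>y\<bar> \<le> real K" using real_arch_simple by blast
        with elim[rule_format, of K] show ?case by simp
      qed
      then have "(CLINT y|\<nu>. ?f u y) = (CLINT y|\<nu>. 0)" for u
        by (intro integral_cong_AE) auto
      then show False using drift True by (simp add: levy_khintchine_def)
    qed
    then obtain K where K: "0 < J K" by blast
    \<comment> \<open>For such \<open>u\<close> and \<open>\<bar>y\<bar> \<le> real K\<close> one
      has \<open>\<bar>u * y\<bar> \<le> 1\<close>, so the quadratic lower bound for
      \<open>1 - cos\<close> applies. The \<open>+ 1\<close> avoids division by zero.\<close>
    have "J K / 3 * u\<^sup>2 \<le> - Re (levy_khintchine b a \<nu> u)" if u: "0 < u" "u < 1 / (real K + 1)" for u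
    proof -
      have "J K / 3 * u\<^sup>2 = (LINT y|\<nu>. u\<^sup>2 / 3 * (y\<^sup>2 * indicator {y. \<bar>y\<bar> \<le> real K} y))"
        by (simp add: J_def)
      also have "\<dots> \<le> (LINT y|\<nu>. 1 - cos (u * y))"
      proof (rule integral_mono)
        show "u\<^sup>2 / 3 * (y\<^sup>2 * indicator {y. \<bar>y\<bar> \<le> real K} y) \<le> 1 - cos (u * y)" for y
        proof (cases "\<bar>y\<bar> \<le> real K")
          case True
          have "\<bar>u * y\<bar> \<le> 1 / (real K + 1) * real K"
            unfolding abs_mult using u True by (intro mult_mono) auto
          also have "\<dots> \<le> 1" by simp
          finally show ?thesis
            using one_minus_cos_ge[of "u * y"] True by (simp add: power_mult_distrib)
        qed simp
      qed (use int_J int_cos in auto)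
      finally show ?thesis unfolding Re_eq using True by simp
    qed
    then show ?thesis
      using K by (intro exI[of _ "J K / 3"] conjI exI[of _ "1 / (real K + 1)"]) auto
  qed
qed

section \<open>The limit\<close>

lemma integral_even:
  fixes f :: "real \<Rightarrow> real"
  assumes int: "integrable lborel f" and even: "\<And>u. f (- u) = f u"
  shows "(LBINT u. f u) = 2 * (LBINT u:{0<..}. f u)"
proof -
  have [measurable]: "f \<in> borel_measurable borel" using int by auto
  have s: "set_integrable lborel A f" if "A \<in> sets borel" for A
    unfolding set_integrable_def using int that by (intro integrable_mult_indicator) auto
  have "(LBINT u. f u) = (LBINT u:{..<0} \<union> {0<..}. f u)"
    unfolding set_lebesgue_integral_def
    by (intro integral_cong_AE AE_I[of _ _ "{0}"]) (auto simp: indicator_def)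
  also have "\<dots> = (LBINT u:{..<0}. f u) + (LBINT u:{0<..}. f u)"
    by (intro set_integral_Un s) auto
  also have "(LBINT u:{..<0}. f u) = (LBINT u:{0<..}. f u)"
    by (subst set_integral_reflect) (simp add: even greaterThan_def)
  finally show ?thesis by simp
qed

text \<open>A bound near the origin that is uniform in \<open>q\<close>. With
  \<open>p = q - Re z\<close> and \<open>B = Im z\<close> the real part splits into a cosine term,
  controlled by the quadratic lower bound, and a sine term, controlled by the integrand of
  (B).\<close>

lemma Re_resolvent_integrand_bound:
  fixes z :: complex and q u x :: real
  assumes "0 \<le> q" "0 < c" "0 < u" and c: "c * u\<^sup>2 \<le> - Re z"
  shows "\<bar>Re ((iexp (u * x) - 1) / (z - q))\<bar> \<le> x\<^sup>2 / (2 * c) + \<bar>x\<bar> * \<bar>Im (u / z)\<bar>"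
proof -
  define A B p where "A = - Re z" and "B = Im z" and "p = q + A"
  have "0 < c * u\<^sup>2" using assms by simp
  with c have A: "0 < A" "c * u\<^sup>2 \<le> A" "A \<le> p" using \<open>0 \<le> q\<close> unfolding A_def p_def by linarith+
  have pos: "0 < p\<^sup>2 + B\<^sup>2" "0 < A\<^sup>2 + B\<^sup>2" using A by (simp_all add: add_pos_nonneg)
  have "Re ((iexp (u * x) - 1) / (z - q)) =
      ((1 - cos (u * x)) * p + sin (u * x) * B) / (p\<^sup>2 + B\<^sup>2)"
  proof -
    have "z - q = Complex (- p) B" by (simp add: complex_eq_iff p_def A_def B_def)
    then show ?thesis
      by (simp add: Re_divide Re_exp Im_exp power2_eq_square diff_divide_distrib add_divide_distrib algebra_simps)
  qed
  also have "\<bar>\<dots>\<bar> \<le> (1 - cos (u * x)) * p / (p\<^sup>2 + B\<^sup>2) + \<bar>sin (u * x)\<bar> * \<bar>B\<bar> / (p\<^sup>2 + B\<^sup>2)"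
    unfolding add_divide_distrib using pos A
    by (intro order.trans[OF abs_triangle_ineq] add_mono) (auto simp: abs_mult)
  also have "(1 - cos (u * x)) * p / (p\<^sup>2 + B\<^sup>2) \<le> x\<^sup>2 / (2 * c)"
  proof -
    \<comment> \<open>Dropping the square of \<open>B\<close> leaves
      \<open>(1 - cos (u * x)) / p\<close>, where numerator and denominator are both compared with
      the square of \<open>u\<close>.\<close>
    have "(1 - cos (u * x)) * p / (p\<^sup>2 + B\<^sup>2) \<le> (1 - cos (u * x)) * p / p\<^sup>2"
      using pos A by (intro divide_left_mono mult_nonneg_nonneg mult_pos_pos) auto
    also have "\<dots> = (1 - cos (u * x)) / p"
      using A by (simp add: power2_eq_square)
    also have "\<dots> \<le> ((u * x)\<^sup>2 / 2) / (c * u\<^sup>2)"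
      using A \<open>0 < c * u\<^sup>2\<close> by (intro frac_le one_minus_cos_le) auto
    also have "\<dots> = x\<^sup>2 / (2 * c)"
      using assms by (simp add: power_mult_distrib)
    finally show ?thesis .
  qed
  also have "\<bar>sin (u * x)\<bar> * \<bar>B\<bar> / (p\<^sup>2 + B\<^sup>2) \<le> \<bar>x\<bar> * \<bar>Im (u / z)\<bar>"
  proof -
    \<comment> \<open>Replacing \<open>p\<close> by the smaller \<open>A\<close> removes
      \<open>q\<close> from the denominator.\<close>
    have "\<bar>sin (u * x)\<bar> * \<bar>B\<bar> / (p\<^sup>2 + B\<^sup>2) \<le> (u * \<bar>x\<bar>) * \<bar>B\<bar> / (A\<^sup>2 + B\<^sup>2)"
      using A pos abs_sin_x_le_abs_x[of "u * x"] assms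
      by (intro frac_le mult_right_mono add_right_mono power_mono) (auto simp: abs_mult)
    also have "\<dots> = \<bar>x\<bar> * \<bar>Im (u / z)\<bar>"
    proof -
      have "Im (u / z) = - (u * B) / (A\<^sup>2 + B\<^sup>2)"
        by (simp add: Im_divide A_def B_def)
      then show ?thesis using assms pos by (simp add: abs_mult)
    qed
    finally show ?thesis .
  qed
  finally show ?thesis by simp
qed

section \<open>Consequences of (A) and passage to the limit\<close>

locale levy_process_integrable_symbol = levy_process_symbol +
  assumes integrable_resolvent_symbol:
    "0 < q \<Longrightarrow> integrable lborel (\<lambda>u. 1 / (of_real q - \<eta> u))"
begin

interpretation \<mu>: real_distribution "exp_time_law 1"
  by (rule real_distribution_exp_time_law) simp

lemma integrable_char_exp_time_law_1: "integrable lborel (char (exp_time_law 1))"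
  using integrable_resolvent_symbol[of 1] by (simp add: char_exp_time_law_1)

text \<open>A zero of \<open>\<eta>\<close> is a point where the characteristic function
  \<open>1 / (1 - \<eta>)\<close> equals 1.\<close>

lemma symbol_nonzero:
  assumes "0 < u"
  shows "\<eta> u \<noteq> 0"
  using \<mu>.char_neq_1[OF integrable_char_exp_time_law_1 assms] by (auto simp: char_exp_time_law_1)

text \<open>Far out \<open>1 / (1 - \<eta>)\<close> has modulus below 1/2, which forces
  \<open>norm (\<eta> u) \<ge> 1\<close>. On the remaining compact interval the continuous modulus
  attains a minimum, positive because \<open>\<eta>\<close> has no zero there.\<close>

lemma symbol_bounded_below:
  assumes "0 < d"
  shows "\<exists>m>0. \<forall>u\<ge>d. m \<le> norm (\<eta> u)"
proof -
  have "eventually (\<lambda>u. norm (char (exp_time_law 1) u) < 1 / 2) at_top"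
    using \<mu>.char_tendsto_0[OF integrable_char_exp_time_law_1]
    by (intro order_tendstoD(2)[of _ 0]) (auto intro: tendsto_norm_zero)
  then obtain K where K: "\<And>u. K \<le> u \<Longrightarrow> norm (1 / (1 - \<eta> u)) < 1 / 2"
    unfolding eventually_at_top_linorder char_exp_time_law_1 by auto
  have large: "1 \<le> norm (\<eta> u)" if "K \<le> u" for u
  proof -
    have "2 < norm (1 - \<eta> u)"
      using K[OF that] symbol_neq[of 1 u] by (simp add: norm_divide divide_simps)
    then show ?thesis using norm_triangle_ineq4[of 1 "\<eta> u"] by simp
  qed
  define K' where "K' = max d K"
  have "continuous_on {d..K'} (\<lambda>u. norm (\<eta> u))"
    by (intro continuous_on_norm continuous_at_imp_continuous_on ballI isCont_symbol)
  then obtain v where v: "v \<in> {d..K'}" "\<And>u. u \<in> {d..K'} \<Longrightarrow> norm (\<eta> v) \<le> norm (\<eta> u)"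
    using continuous_attains_inf[of "{d..K'}" "\<lambda>u. norm (\<eta> u)"] by (auto simp: K'_def)
  have "0 < norm (\<eta> v)" using symbol_nonzero[of v] v(1) assms by simp
  moreover have "min 1 (norm (\<eta> v)) \<le> norm (\<eta> u)" if "d \<le> u" for u
  proof (cases "u \<le> K'")
    case True
    then show ?thesis using v(2)[of u] that by (simp add: min.coboundedI2)
  next
    case False
    then have "K \<le> u" by (simp add: K'_def)
    then show ?thesis using large by (simp add: min.coboundedI1)
  qed
  ultimately show ?thesis by (intro exI[of _ "min 1 (norm (\<eta> v))"]) auto
qed

text \<open>Subtract the inversion integrals at 0 and \<open>- x\<close>. Conjugate symmetry of
  \<open>\<eta>\<close> makes the real part of the integrand even, so the integral folds onto the
  half-line and the factor \<open>1 / (2 * pi)\<close> becomes \<open>1 / pi\<close>.\<close>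

lemma h_resolvent_eq:
  assumes q: "0 < q"
  shows "h_resolvent M X q x = 1 / pi * (LBINT u:{0<..}. Re ((iexp (u * x) - 1) / (\<eta> u - q)))"
proof -
  let ?g = "\<lambda>u. 1 / (q - \<eta> u)"
  let ?f = "\<lambda>u. Re ((iexp (u * x) - 1) / (\<eta> u - q))"
  have int: "integrable lborel (\<lambda>u. iexp (u * x) * ?g u)"
    by (rule integrable_iexp_mult[OF integrable_resolvent_symbol[OF q]])
  have f_eq: "(iexp (u * x) - 1) / (\<eta> u - q) = ?g u - iexp (u * x) * ?g u" for u
    using symbol_neq[OF q, of u] by (simp add: divide_simps) (simp add: algebra_simps)
  have int_f: "integrable lborel (\<lambda>u. (iexp (u * x) - 1) / (\<eta> u - q))"
    unfolding f_eq using integrable_resolvent_symbol[OF q] int by (rule Bochner_Integration.integrable_diff)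
  have "h_resolvent M X q x = Re (inverse_char ?g 0 - inverse_char ?g (- x))"
    unfolding h_resolvent_def resolvent_density_eq[OF q integrable_resolvent_symbol[OF q]] by simp
  also have "inverse_char ?g 0 - inverse_char ?g (- x) =
      (CLBINT u. ?g u - iexp (u * x) * ?g u) / (2 * pi)"
    unfolding inverse_char_def
    using Bochner_Integration.integral_diff[OF integrable_resolvent_symbol[OF q] int] by (simp add: diff_divide_distrib)
  also have "Re \<dots> = Re (CLBINT u. (iexp (u * x) - 1) / (\<eta> u - q)) / (2 * pi)"
    unfolding f_eq using Re_divide_of_real[of _ "2 * pi"] by simp
  also have "\<dots> = (LBINT u. ?f u) / (2 * pi)"
    using int_f by (simp only: integral_Re)
  also have "(LBINT u. ?f u) = 2 * (LBINT u:{0<..}. ?f u)"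
  proof (rule integral_even)
    show "integrable lborel ?f" using int_f by (rule integrable_Re)
    show "?f (- u) = ?f u" for u
    proof -
      have "(iexp (- u * x) - 1) / (\<eta> (- u) - q) = cnj ((iexp (u * x) - 1) / (\<eta> u - q))"
        by (simp add: symbol_minus exp_cnj)
      then show ?thesis by (simp only: cnj.simps(1))
    qed
  qed
  finally show ?thesis by simp
qed

text \<open>A pure drift would contradict (A) at \<open>q = 1\<close>, so the quadratic lower bound
  for Levy-Khintchine exponents applies.\<close>

lemma Re_symbol_lower_bound:
  assumes "0 \<le> a" "levy_measure \<nu>" "\<eta> = levy_khintchine b a \<nu>"
  obtains c d where "0 < c" "0 < d" "\<And>u. 0 < u \<Longrightarrow> u < d \<Longrightarrow> c * u\<^sup>2 \<le> - Re (\<eta> u)"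
proof -
  have "\<not> (\<forall>u. \<eta> u = \<i> * of_real b * of_real u)"
  proof
    assume "\<forall>u. \<eta> u = \<i> * of_real b * of_real u"
    then have "\<eta> = (\<lambda>u. \<i> * of_real b * of_real u)" by blast
    then show False using integrable_resolvent_symbol[of 1] not_integrable_inverse_linear[of b] by simp
  qed
  then show thesis
    using levy_khintchine_Re_lower_bound[OF assms(1,2), of b] that unfolding assms(3)[symmetric] by blast
qed

lemma resolvent_limit:
  assumes lower: "0 < c" "0 < d" "\<And>u. 0 < u \<Longrightarrow> u < d \<Longrightarrow> c * u\<^sup>2 \<le> - Re (\<eta> u)"
    and B: "set_integrable lborel {0<..<1} (\<lambda>u. \<bar>Im (of_real u / \<eta> u)\<bar>)"
  shows "set_integrable lborel {0<..} (\<lambda>u. Re ((iexp (u * x) - 1) / \<eta> u))" (is ?int)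
    and "((\<lambda>q. h_resolvent M X q x) \<longlongrightarrow>
       1 / pi * (LBINT u:{0<..}. Re ((iexp (u * x) - 1) / \<eta> u))) (at_right 0)" (is ?lim)
proof -
  \<comment> \<open>The cap at 1 keeps the range near the origin inside the interval on which (B) is
    available.\<close>
  define d' where "d' = min d 1"
  have d': "0 < d'" "d' \<le> d" "d' \<le> 1" using lower by (auto simp: d'_def)
  obtain m where m: "0 < m" "\<And>u. d' \<le> u \<Longrightarrow> m \<le> norm (\<eta> u)"
    using symbol_bounded_below[OF d'(1)] by blast
  define F where "F q u = Re ((iexp (u * x) - 1) / (\<eta> u - of_real q))" for q u :: real
  \<comment> \<open>A majorant independent of \<open>q\<close>: the first two summands dominate the
    cosine and sine parts on \<open>{0<..<d'}\<close>, the third dominates everything from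
    \<open>d'\<close> onwards and is integrable by (A).\<close>
  define w where "w u = x\<^sup>2 / (2 * c) * indicator {0<..<d'} u
      + \<bar>x\<bar> * (indicator {0<..<1} u * \<bar>Im (of_real u / \<eta> u)\<bar>)
      + 2 * (1 / m + 1) * norm (1 / (1 - \<eta> u))" for u
  have w_int: "integrable lborel w"
    unfolding w_def
  proof (intro Bochner_Integration.integrable_add integrable_mult_right integrable_norm)
    show "integrable lborel (\<lambda>u. indicator {0<..<1} u * \<bar>Im (of_real u / \<eta> u)\<bar>)"
      using B by (simp add: set_integrable_def)
    show "integrable lborel (\<lambda>u. 1 / (1 - \<eta> u))"
      using integrable_resolvent_symbol[of 1] by simp
    show "integrable lborel (\<lambda>u. indicator {0<..<d'} u :: real)"
      using d' by (intro integrable_real_indicator) auto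
  qed
  \<comment> \<open>Including \<open>q = 0\<close> makes the same bound yield integrability of the
    limit integrand.\<close>
  have F_le: "\<bar>F q u\<bar> \<le> w u" if "0 \<le> q" "0 < u" for q u
  proof (cases "u < d'")
    case True
    have "\<bar>F q u\<bar> \<le> x\<^sup>2 / (2 * c) + \<bar>x\<bar> * \<bar>Im (u / \<eta> u)\<bar>"
      unfolding F_def by (rule Re_resolvent_integrand_bound) (use that True d' lower in auto)
    also have "\<dots> \<le> w u"
      unfolding w_def using that True d' m by simp
    finally show ?thesis .
  next
    case False
    then have mu: "m \<le> norm (\<eta> u)" using m by simp
    \<comment> \<open>As \<open>Re (\<eta> u) \<le> 0 \<le> q\<close>, subtracting \<open>q\<close>
      can only enlarge the modulus of the real part.\<close>
    have "norm (\<eta> u) \<le> norm (\<eta> u - q)"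
      using Re_symbol_nonpos[of u] that
      by (auto simp: cmod_def intro!: real_sqrt_le_mono add_mono abs_le_square_iff[THEN iffD1])
    \<comment> \<open>The summand \<open>1 / m\<close> absorbs the constant 1, since
      \<open>m \<le> norm (\<eta> u)\<close>.\<close>
    moreover have "norm (1 - \<eta> u) \<le> (1 / m + 1) * norm (\<eta> u)"
    proof -
      have "1 \<le> 1 / m * norm (\<eta> u)" using mu m by simp
      then show ?thesis using norm_triangle_ineq4[of 1 "\<eta> u"] by (simp add: algebra_simps)
    qed
    ultimately have le: "norm (1 - \<eta> u) \<le> (1 / m + 1) * norm (\<eta> u - q)"
      using m by (elim order.trans) (auto intro!: mult_left_mono)
    have pos: "0 < norm (1 - \<eta> u)" "0 < norm (\<eta> u - q)"
      using symbol_neq[of 1 u] mu m \<open>norm (\<eta> u) \<le> norm (\<eta> u - q)\<close> by auto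
    have "\<bar>F q u\<bar> \<le> norm (iexp (u * x) - 1) / norm (\<eta> u - q)"
      unfolding F_def norm_divide[symmetric] by (rule abs_Re_le_cmod)
    also have "\<dots> \<le> 2 / norm (\<eta> u - q)"
      using norm_triangle_ineq4[of "iexp (u * x)" 1] by (intro divide_right_mono) auto
    also have "\<dots> \<le> 2 * (1 / m + 1) * norm (1 / (1 - \<eta> u))"
      using le pos by (simp add: norm_divide field_simps)
    also have "\<dots> \<le> w u"
      unfolding w_def using lower by simp
    finally show ?thesis .
  qed
  have F_meas [measurable]: "F q \<in> borel_measurable borel" for q
    unfolding F_def by measurable
  have bound: "norm (indicator {0<..} u *\<^sub>R F q u) \<le> norm (w u)" if "0 \<le> q" for q u
    using F_le[OF that, of u] by (auto simp: indicator_def)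
  have "integrable lborel (\<lambda>u. indicator {0<..} u *\<^sub>R F 0 u)"
    by (rule Bochner_Integration.integrable_bound[OF w_int]) (use bound[of 0] in auto)
  then show ?int
    by (simp add: set_integrable_def F_def)
  have "((\<lambda>q. LBINT u. indicator {0<..} u *\<^sub>R F q u) \<longlongrightarrow> (LBINT u. indicator {0<..} u *\<^sub>R F 0 u)) (at_right 0)"
  \<comment> \<open>Dominated convergence is applied along sequences, which determine the one-sided
    limit.\<close>
  proof (rule tendsto_at_right_sequentially[where b=1])
    fix S :: "nat \<Rightarrow> real" assume S: "\<And>n. 0 < S n" "S \<longlonglongrightarrow> 0"
    show "(\<lambda>n. LBINT u. indicator {0<..} u *\<^sub>R F (S n) u) \<longlonglongrightarrow> (LBINT u. indicator {0<..} u *\<^sub>R F 0 u)"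
    proof (rule integral_dominated_convergence[where w="\<lambda>u. norm (w u)"])
      show "AE u in lborel. (\<lambda>n. indicator {0<..} u *\<^sub>R F (S n) u) \<longlonglongrightarrow> indicator {0<..} u *\<^sub>R F 0 u"
      proof (rule AE_I2)
        fix u :: real
        show "(\<lambda>n. indicator {0<..} u *\<^sub>R F (S n) u) \<longlonglongrightarrow> indicator {0<..} u *\<^sub>R F 0 u"
        proof (cases "0 < u")
          case True
          have "(\<lambda>n. F (S n) u) \<longlonglongrightarrow> F 0 u"
            unfolding F_def using symbol_nonzero[OF True]
            by (intro tendsto_Re tendsto_divide tendsto_diff tendsto_const tendsto_of_real S(2)) simp
          then show ?thesis by (intro tendsto_scaleR tendsto_const)
        qed simp
      qed
      show "AE u in lborel. norm (indicator {0<..} u *\<^sub>R F (S n) u) \<le> norm (w u)" for n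
        using bound[OF less_imp_le[OF S(1)]] by simp
    qed (use w_int in auto)
  qed simp
  then have "((\<lambda>q. 1 / pi * (LBINT u:{0<..}. F q u)) \<longlongrightarrow> 1 / pi * (LBINT u:{0<..}. F 0 u)) (at_right 0)"
    unfolding set_lebesgue_integral_def by (intro tendsto_mult tendsto_const)
  moreover have "eventually (\<lambda>q. 1 / pi * (LBINT u:{0<..}. F q u) = h_resolvent M X q x) (at_right 0)"
    using eventually_at_right_less[of 0] by eventually_elim (simp add: h_resolvent_eq F_def)
  ultimately have "((\<lambda>q. h_resolvent M X q x) \<longlongrightarrow> 1 / pi * (LBINT u:{0<..}. F 0 u)) (at_right 0)"
    by (rule Lim_transform_eventually)
  then show ?lim by (simp add: F_def)
qed

end

text \<open>Integrability of the limit integrand is part of the conclusion because the integral of a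
  non-integrable function would be 0 by convention.\<close>

theorem theorem3p6:
  fixes M :: "'a measure" and X :: "real \<Rightarrow> 'a \<Rightarrow> real" and \<eta> :: "real \<Rightarrow> complex"
  assumes "levy_process M X"
    and "has_levy_symbol M X \<eta>"
    and A: "\<And>q::real. 0 < q \<Longrightarrow> integrable lborel (\<lambda>u. 1 / (of_real q - \<eta> u))"
    and B: "set_integrable lborel {0<..<1} (\<lambda>u. \<bar>Im (of_real u / \<eta> u)\<bar>)"
  shows "\<forall>x::real.
    set_integrable lborel {0<..} (\<lambda>u. Re ((iexp (u * x) - 1) / \<eta> u)) \<and>
    ((\<lambda>q. h_resolvent M X q x) \<longlongrightarrow>
       1 / pi * (LBINT u:{0<..}. Re ((iexp (u * x) - 1) / \<eta> u))) (at_right 0)"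
proof -
  interpret levy_process_symbol M X \<eta>
    using assms(1,2) by (intro levy_process_symbol.intro levy_process_symbol_axioms.intro)
      (auto simp: has_levy_symbol_def)
  interpret levy_process_integrable_symbol M X \<eta>
    by unfold_locales (rule A)
  obtain b a \<nu> where "0 \<le> a" "levy_measure \<nu>" "\<eta> = levy_khintchine b a \<nu>"
    using assms(2) by (auto simp: has_levy_symbol_def)
  then obtain c d where "0 < c" "0 < d" "\<And>u. 0 < u \<Longrightarrow> u < d \<Longrightarrow> c * u\<^sup>2 \<le> - Re (\<eta> u)"
    by (rule Re_symbol_lower_bound) (rule that; blast)
  then show ?thesis
    using resolvent_limit[OF _ _ _ B] by blast
qed

end
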